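(* Let $n\ge1$ and let $X\in\{\mathfrak{G}^{\mathrm{II}}_{2n},\mathfrak{G}^{\mathrm{III}}_{2n},\mathfrak{G}^{\mathrm{IV}}_{2n}\}$. For every region $R$ of $\mathcal{K}_{2n}$ there is exactly one permutation in $X$ compatible with $R$, and the resulting map $\mathcal{R}(\mathcal{K}_{2n})\to X$ (denoted $\Lambda^{\mathrm{II}},\Lambda^{\mathrm{III}},\Lambda^{\mathrm{IV}}$ respectively) is a bijection.
   Context: $\mathcal{K}_{2n}$ is the arrangement in $\mathbb{R}^{2n+1}$ of the hyperplanes $x_{2i-1}-x_{2j}=0$, $1\le i\le j\le n$; $\mathcal{R}(\mathcal{K}_{2n})$ is its set of regions (connected components of the complement). A permutation $\pi$ of $[2n]$ is compatible with a region $R$ if for every pair $(i,j)$ with $i<j$, $i$ odd, $j$ even, and every $\mathbf{x}\in R$: $\pi^{-1}(i)<\pi^{-1}(j)$ iff $x_i<x_j$. Parity patterns for a permutation $\sigma=\sigma_1\cdots\sigma_{2n}$ at adjacent positions $(\sigma_i,\sigma_{i+1})$: $\mathrm{eE}$ = ascent with both even; $\mathrm{eO}$ = ascent with $\sigma_i$ even, $\sigma_{i+1}$ odd; $\mathrm{oO}$ = ascent with both odd; $\mathrm{Ee}$ = descent with both even; $\mathrm{Oe}$ = descent with $\sigma_i$ odd, $\sigma_{i+1}$ even; $\mathrm{Oo}$ = descent with both odd. $\mathfrak{G}^{\mathrm{II}}_{2n}$: permutations $\sigma$ of $[2n]$ containing no $\mathrm{Ee}$, $\mathrm{eO}$, $\mathrm{oO}$,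 and such that whenever $(\sigma_m,\sigma_{m+1})$ is an $\mathrm{Oe}$ pattern, $\sigma_1,\dots,\sigma_m$ are all odd and $\sigma_1>\sigma_2>\cdots>\sigma_m$. $\mathfrak{G}^{\mathrm{III}}_{2n}$: permutations of $[2n]$ containing no $\mathrm{Oo}$ and no $\mathrm{eE}$, and no $\mathrm{eO}_d$ for any $d\ge0$, where a pair $(\sigma_i,\sigma_j)$ is an $\mathrm{eO}_d$ if $j=i+d+1$, $\sigma_i$ is even, $\sigma_l$ is odd for all $i<l\le j$, and $\sigma_i<\sigma_j$. $\mathfrak{G}^{\mathrm{IV}}_{2n}$: permutations of $[2n]$ containing no $\mathrm{eO}$, and no $\mathrm{Oo}_d$ or $\mathrm{Ee}_d$ for any $d\ge0$, where: $(\sigma_i,\sigma_j)$ is an $\mathrm{Oo}_d$ if $\sigma_i,\sigma_j$ are odd, the factor $\alpha=\sigma_{i+1}\cdots\sigma_{j-1}$ has length $d$ and consists only of even letters, and $\sigma_i>\sigma_j$ when $d=0$, $\sigma_i>\max(\alpha)>\sigma_j$ when $d>0$; $(\sigma_i,\sigma_j)$ is an $\mathrm{Ee}_d$ if $\sigma_i,\sigma_j$ are even, $\alpha=\sigma_{i+1}\cdots\sigma_{j-1}$ has length $d$ and consists only of odd letters, and $\sigma_i>\sigma_j$ when $d=0$, $\sigma_i>\min(\alpha)>\sigma_j$ when $d>0$. *)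

theory Defs
  imports "HOL-Analysis.Analysis"
begin

text \<open>
  The space \<open>\<real>\<^sup>2\<^sup>n\<^sup>+\<^sup>1\<close> is the product topology \<^term>\<open>powertop_real {1..2*n+1}\<close>; its points are the
  real functions on the index set \<open>{1..2*n+1}\<close>, with the value \<^term>\<open>undefined\<close> outside it.
\<close>

abbreviation ambient :: "nat \<Rightarrow> (nat \<Rightarrow> real) topology" where
  "ambient n \<equiv> powertop_real {1..2*n+1}"

definition arrangement :: "nat \<Rightarrow> (nat \<Rightarrow> real) set set" where
  "arrangement n =
     {{x \<in> topspace (ambient n). x (2*i-1) - x (2*j) = 0} | i j. 1 \<le> i \<and> i \<le> j \<and> j \<le> n}"

definition regions :: "nat \<Rightarrow> (nat \<Rightarrow> real) set set" where
  "regions n = connected_components_of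
     (subtopology (ambient n) (topspace (ambient n) - \<Union>(arrangement n)))"

text \<open>
  A permutation of \<open>[2n]\<close> is a function \<open>\<sigma>\<close> with \<^prop>\<open>\<sigma> permutes {1..2*n}\<close>, the word being
  \<open>\<sigma> 1, \<dots>, \<sigma> (2n)\<close>. A pattern predicate takes the positions of its pair of letters; the range of
  the positions is imposed where the pattern is used.
\<close>

definition compatible :: "nat \<Rightarrow> (nat \<Rightarrow> nat) \<Rightarrow> (nat \<Rightarrow> real) set \<Rightarrow> bool" where
  "compatible n \<pi> R \<longleftrightarrow>
     (\<forall>i\<in>{1..2*n}. \<forall>j\<in>{1..2*n}. i < j \<and> odd i \<and> even j \<longrightarrow>
        (\<forall>x\<in>R. inv \<pi> i < inv \<pi> j \<longleftrightarrow> x i < x j))"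

definition asc_eE :: "(nat \<Rightarrow> nat) \<Rightarrow> nat \<Rightarrow> bool" where
  "asc_eE \<sigma> i \<longleftrightarrow> even (\<sigma> i) \<and> even (\<sigma> (i+1)) \<and> \<sigma> i < \<sigma> (i+1)"

definition asc_eO :: "(nat \<Rightarrow> nat) \<Rightarrow> nat \<Rightarrow> bool" where
  "asc_eO \<sigma> i \<longleftrightarrow> even (\<sigma> i) \<and> odd (\<sigma> (i+1)) \<and> \<sigma> i < \<sigma> (i+1)"

definition asc_oO :: "(nat \<Rightarrow> nat) \<Rightarrow> nat \<Rightarrow> bool" where
  "asc_oO \<sigma> i \<longleftrightarrow> odd (\<sigma> i) \<and> odd (\<sigma> (i+1)) \<and> \<sigma> i < \<sigma> (i+1)"

definition desc_Ee :: "(nat \<Rightarrow> nat) \<Rightarrow> nat \<Rightarrow> bool" where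
  "desc_Ee \<sigma> i \<longleftrightarrow> even (\<sigma> i) \<and> even (\<sigma> (i+1)) \<and> \<sigma> i > \<sigma> (i+1)"

definition desc_Oe :: "(nat \<Rightarrow> nat) \<Rightarrow> nat \<Rightarrow> bool" where
  "desc_Oe \<sigma> i \<longleftrightarrow> odd (\<sigma> i) \<and> even (\<sigma> (i+1)) \<and> \<sigma> i > \<sigma> (i+1)"

definition desc_Oo :: "(nat \<Rightarrow> nat) \<Rightarrow> nat \<Rightarrow> bool" where
  "desc_Oo \<sigma> i \<longleftrightarrow> odd (\<sigma> i) \<and> odd (\<sigma> (i+1)) \<and> \<sigma> i > \<sigma> (i+1)"

definition dist_eO :: "nat \<Rightarrow> (nat \<Rightarrow> nat) \<Rightarrow> nat \<Rightarrow> nat \<Rightarrow> bool" where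
  "dist_eO d \<sigma> i j \<longleftrightarrow>
     j = i + d + 1 \<and> even (\<sigma> i) \<and> (\<forall>l. i < l \<and> l \<le> j \<longrightarrow> odd (\<sigma> l)) \<and> \<sigma> i < \<sigma> j"

definition dist_Oo :: "nat \<Rightarrow> (nat \<Rightarrow> nat) \<Rightarrow> nat \<Rightarrow> nat \<Rightarrow> bool" where
  "dist_Oo d \<sigma> i j \<longleftrightarrow>
     j = i + d + 1 \<and> odd (\<sigma> i) \<and> odd (\<sigma> j) \<and> (\<forall>l\<in>{i<..<j}. even (\<sigma> l)) \<and>
     (if d = 0 then \<sigma> i > \<sigma> j
      else \<sigma> i > Max (\<sigma> ` {i<..<j}) \<and> Max (\<sigma> ` {i<..<j}) > \<sigma> j)"

definition dist_Ee :: "nat \<Rightarrow> (nat \<Rightarrow> nat) \<Rightarrow> nat \<Rightarrow> nat \<Rightarrow> bool" where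
  "dist_Ee d \<sigma> i j \<longleftrightarrow>
     j = i + d + 1 \<and> even (\<sigma> i) \<and> even (\<sigma> j) \<and> (\<forall>l\<in>{i<..<j}. odd (\<sigma> l)) \<and>
     (if d = 0 then \<sigma> i > \<sigma> j
      else \<sigma> i > Min (\<sigma> ` {i<..<j}) \<and> Min (\<sigma> ` {i<..<j}) > \<sigma> j)"

definition G_II :: "nat \<Rightarrow> (nat \<Rightarrow> nat) set" where
  "G_II n = {\<sigma>. \<sigma> permutes {1..2*n} \<and>
     (\<forall>m\<in>{1..<2*n}. \<not> desc_Ee \<sigma> m \<and> \<not> asc_eO \<sigma> m \<and> \<not> asc_oO \<sigma> m) \<and>
     (\<forall>m\<in>{1..<2*n}. desc_Oe \<sigma> m \<longrightarrow>
        (\<forall>k\<in>{1..m}. odd (\<sigma> k)) \<and> (\<forall>k\<in>{1..<m}. \<sigma> k > \<sigma> (k+1)))}"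

definition G_III :: "nat \<Rightarrow> (nat \<Rightarrow> nat) set" where
  "G_III n = {\<sigma>. \<sigma> permutes {1..2*n} \<and>
     (\<forall>m\<in>{1..<2*n}. \<not> desc_Oo \<sigma> m \<and> \<not> asc_eE \<sigma> m) \<and>
     (\<forall>d. \<forall>i\<in>{1..2*n}. \<forall>j\<in>{1..2*n}. \<not> dist_eO d \<sigma> i j)}"

definition G_IV :: "nat \<Rightarrow> (nat \<Rightarrow> nat) set" where
  "G_IV n = {\<sigma>. \<sigma> permutes {1..2*n} \<and>
     (\<forall>m\<in>{1..<2*n}. \<not> asc_eO \<sigma> m) \<and>
     (\<forall>d. \<forall>i\<in>{1..2*n}. \<forall>j\<in>{1..2*n}. \<not> dist_Oo d \<sigma> i j \<and> \<not> dist_Ee d \<sigma> i j)}"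

text \<open>The map \<open>\<Lambda>\<close> of a class \<open>X\<close>; meaningful when \<open>X\<close> has a unique member compatible with \<open>R\<close>.\<close>

definition region_perm :: "nat \<Rightarrow> (nat \<Rightarrow> nat) set \<Rightarrow> (nat \<Rightarrow> real) set \<Rightarrow> (nat \<Rightarrow> nat)" where
  "region_perm n X R = (THE \<sigma>. \<sigma> \<in> X \<and> compatible n \<sigma> R)"

end

theory Submission
  imports Defs
begin

text \<open>
  Record a permutation by its arcs, the pairs of an odd letter and a larger even letter, directed
  by the order in which they occur. Regions are convex cells cut out by the strict inequalities
  of an arc set, so each class has to contain exactly one permutation with a prescribed arc set;
  letters not joined by an arc may be commuted freely.

  Class II is a Foata normal form: the level of a letter is the length of the longest alternating
  chain of arcs ending in it, and the permutation lists the levels one after the other. Class IV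
  keeps the even letters at their levels, but each odd letter is moved as far to the right as its
  even successors permit. So the members of II and IV are the permutations along which an
  explicit key, depending only on the arcs, increases. Class III consists of the lexicographic
  normal forms: no letter can be commuted to the left across a letter that it should precede.
\<close>

section \<open>Arcs of a permutation\<close>

text \<open>The forbidden patterns are local while compatibility is global. The bridge is that a
  word is sorted by a key as soon as the key increases at every adjacent pair, so members of II and
  IV are handled pair by pair; conversely, a forbidden pattern in a sorted word is refuted by the
  letter that realises a level or a place. Class III gets no explicit key, because the greedy choice
  of the next letter depends on the word built so far: existence comes from lexicographic
  minimality, uniqueness from the first position where two words differ.

  The delicate point of class IV is the odd letters without even successor. A word can end in a
  block of odd letters after the top level only if some arc leads from that level into the block,
  since otherwise an \<open>eO\<close> would occur where the block begins. Without such an arc these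
  letters have to stay just before the last even block.\<close>

definition edge :: "nat \<Rightarrow> nat \<Rightarrow> bool" where
  "edge a b \<longleftrightarrow> odd a \<and> even b \<and> a < b \<or> even a \<and> odd b \<and> b < a"

definition arcs :: "nat \<Rightarrow> (nat \<Rightarrow> nat) \<Rightarrow> (nat \<times> nat) set" where
  "arcs N \<sigma> = {(\<sigma> i, \<sigma> j) | i j. 1 \<le> i \<and> i < j \<and> j \<le> N \<and> edge (\<sigma> i) (\<sigma> j)}"

definition sorted_by :: "(nat \<Rightarrow> nat) \<Rightarrow> nat \<Rightarrow> (nat \<Rightarrow> nat) \<Rightarrow> bool" where
  "sorted_by K N \<sigma> \<longleftrightarrow> (\<forall>i\<in>{1..<N}. K (\<sigma> i) < K (\<sigma> (i+1)))"

lemma edge_sym: "edge a b \<longleftrightarrow> edge b a"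
  by (auto simp: edge_def)

lemma arcsI: "1 \<le> i \<Longrightarrow> i < j \<Longrightarrow> j \<le> N \<Longrightarrow> edge (\<sigma> i) (\<sigma> j) \<Longrightarrow> (\<sigma> i, \<sigma> j) \<in> arcs N \<sigma>"
  unfolding arcs_def by blast

lemma arcsE:
  assumes "(a, b) \<in> arcs N \<sigma>"
  obtains i j where "a = \<sigma> i" "b = \<sigma> j" "1 \<le> i" "i < j" "j \<le> N" "edge (\<sigma> i) (\<sigma> j)"
  using assms unfolding arcs_def by blast

lemma arcs_edge: "(a, b) \<in> arcs N \<sigma> \<Longrightarrow> edge a b"
  by (auto elim: arcsE)

lemma permutes_eq_iff: "\<sigma> permutes S \<Longrightarrow> \<sigma> i = \<sigma> j \<longleftrightarrow> i = j"
  by (metis permutes_inj injD)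

lemma permutes_mem: "\<sigma> permutes {1..N} \<Longrightarrow> 1 \<le> i \<Longrightarrow> i \<le> N \<Longrightarrow> 1 \<le> \<sigma> i \<and> \<sigma> i \<le> (N::nat)"
  using permutes_in_image[of \<sigma> "{1..N}" i] by simp

lemma permutes_posE:
  assumes "\<sigma> permutes {1..N::nat}" "1 \<le> a" "a \<le> N"
  obtains i where "1 \<le> i" "i \<le> N" "a = \<sigma> i"
  using permutes_image[OF assms(1)] assms(2,3) by (metis atLeastAtMost_iff imageE)

lemma arcs_mem:
  assumes "(a, b) \<in> arcs N \<sigma>" "\<sigma> permutes {1..N}"
  shows "1 \<le> a" "a \<le> N" "1 \<le> b" "b \<le> N"
proof -
  obtain i j where "a = \<sigma> i" "b = \<sigma> j" "1 \<le> i" "i < j" "j \<le> N"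
    using assms(1) by (blast elim: arcsE)
  then show "1 \<le> a" "a \<le> N" "1 \<le> b" "b \<le> N"
    using permutes_mem[OF assms(2), of i] permutes_mem[OF assms(2), of j] by auto
qed

lemma arcs_nth:
  assumes "\<sigma> permutes {1..N}" "1 \<le> i" "i \<le> N" "1 \<le> j" "j \<le> N"
  shows "(\<sigma> i, \<sigma> j) \<in> arcs N \<sigma> \<longleftrightarrow> i < j \<and> edge (\<sigma> i) (\<sigma> j)"
  using assms by (auto intro: arcsI elim!: arcsE simp: permutes_eq_iff[OF assms(1)])

lemma arcs_inv:
  assumes "\<sigma> permutes {1..N}" "1 \<le> a" "a \<le> N" "1 \<le> b" "b \<le> N"
  shows "(a, b) \<in> arcs N \<sigma> \<longleftrightarrow> inv \<sigma> a < inv \<sigma> b \<and> edge a b"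
proof -
  obtain i j where "1 \<le> i" "i \<le> N" "a = \<sigma> i" "1 \<le> j" "j \<le> N" "b = \<sigma> j"
    using permutes_posE[OF assms(1)] assms by metis
  then show ?thesis
    using arcs_nth[OF assms(1)] permutes_inverses(2)[OF assms(1)] by simp
qed

lemma arcs_antisym:
  assumes "(a, b) \<in> arcs N \<sigma>" "\<sigma> permutes {1..N}"
  shows "(b, a) \<notin> arcs N \<sigma>"
  using assms arcs_inv[OF assms(2)] arcs_mem[OF assms] by (metis order_less_asym)

lemma arcs_total:
  assumes "\<sigma> permutes {1..N}" "1 \<le> a" "a \<le> N" "1 \<le> b" "b \<le> N" "edge a b"
  shows "(a, b) \<in> arcs N \<sigma> \<or> (b, a) \<in> arcs N \<sigma>"
proof -
  have "inv \<sigma> a \<noteq> inv \<sigma> b"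
    using assms(6) permutes_eq_iff[OF permutes_inv[OF assms(1)], of a b] by (auto simp: edge_def)
  then show ?thesis
    using arcs_inv[OF assms(1)] assms edge_sym by (metis nat_neq_iff)
qed

text \<open>Both sets orient every edge exactly once, so neither can be a proper part of the
  other.\<close>

lemma arcs_subset_eq:
  assumes "\<sigma> permutes {1..N}" "\<tau> permutes {1..N}" "arcs N \<sigma> \<subseteq> arcs N \<tau>"
  shows "arcs N \<sigma> = arcs N \<tau>"
proof -
  have "(a, b) \<in> arcs N \<sigma>" if "(a, b) \<in> arcs N \<tau>" for a b
    using arcs_total[OF assms(1) arcs_mem[OF that assms(2)] arcs_edge[OF that]]
      arcs_antisym[OF that assms(2)] assms(3) by blast
  with assms(3) show ?thesis by auto
qed

section \<open>Sorting by a key\<close>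

lemma sorted_by_less:
  assumes "sorted_by K N \<sigma>" "1 \<le> i" "i < j" "j \<le> N"
  shows "K (\<sigma> i) < K (\<sigma> j)"
  using assms(3,4)
proof (induction j)
  case (Suc j)
  have "K (\<sigma> j) < K (\<sigma> (Suc j))" if "1 \<le> j"
    using assms(1) Suc.prems that by (auto simp: sorted_by_def)
  with Suc assms(2) show ?case
    by (metis Suc_leD less_antisym less_trans order_trans less_imp_le)
qed simp

text \<open>The rank of a letter under the key is its position, so the word is the inverse of the
  ranking.\<close>

lemma sorted_by_ex:
  assumes "inj_on K {1..N}"
  shows "\<exists>\<sigma>. \<sigma> permutes {1..N} \<and> sorted_by K N \<sigma>"
proof -
  \<comment> \<open>The value \<open>a\<close> outside \<open>{1..N}\<close> is what
    \<open>permutes\<close> demands there.\<close>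
  define r where "r a = (if a \<in> {1..N} then card {b\<in>{1..N}. K b \<le> K a} else a)" for a
  have mono: "r a < r b" if "a \<in> {1..N}" "b \<in> {1..N}" "K a < K b" for a b
  proof -
    have "b \<in> {c\<in>{1..N}. K c \<le> K b} - {c\<in>{1..N}. K c \<le> K a}"
      "{c\<in>{1..N}. K c \<le> K a} \<subseteq> {c\<in>{1..N}. K c \<le> K b}"
      using that by auto
    then have "{c\<in>{1..N}. K c \<le> K a} \<subset> {c\<in>{1..N}. K c \<le> K b}" by blast
    then show ?thesis using that by (simp add: r_def psubset_card_mono)
  qed
  have "inj_on r {1..N}"
  proof (rule inj_onI)
    fix a b assume "a \<in> {1..N}" "b \<in> {1..N}" "r a = r b"
    then show "a = b" using mono assms by (metis inj_onD less_irrefl linorder_neqE_nat)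
  qed
  moreover have "r ` {1..N} \<subseteq> {1..N}"
  proof (rule image_subsetI)
    fix a assume a: "a \<in> {1..N}"
    have "card {b\<in>{1..N}. K b \<le> K a} \<le> card {1..N}" by (rule card_mono) auto
    moreover have "card {b\<in>{1..N}. K b \<le> K a} > 0" using a by (auto simp: card_gt_0_iff)
    ultimately show "r a \<in> {1..N}" using a by (simp add: r_def)
  qed
  ultimately have "bij_betw r {1..N} {1..N}"
    by (simp add: bij_betw_def endo_inj_surj)
  then have p: "r permutes {1..N}"
    by (rule bij_imp_permutes) (unfold r_def, rule if_not_P)
  have "sorted_by K N (inv r)"
    unfolding sorted_by_def
  proof
    fix i assume i: "i \<in> {1..<N}"
    have mem: "inv r i \<in> {1..N}" "inv r (i+1) \<in> {1..N}"
      using i permutes_in_image[OF permutes_inv[OF p]] by auto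
    have eq: "r (inv r i) = i" "r (inv r (i+1)) = i+1"
      using permutes_inverses(1)[OF p] by auto
    then have "inv r i \<noteq> inv r (i+1)" by (metis Suc_eq_plus1 n_not_Suc_n)
    then have "K (inv r i) \<noteq> K (inv r (i+1))" using mem assms by (auto dest: inj_onD)
    then show "K (inv r i) < K (inv r (i+1))"
      using mono[OF mem(2,1)] eq by linarith
  qed
  with permutes_inv[OF p] show ?thesis by blast
qed

text \<open>In a sorted word the letters with key at most that of the \<open>i\<close>-th one are
  exactly the first \<open>i\<close>, so the key alone determines every position.\<close>

lemma sorted_by_unique:
  assumes "\<sigma> permutes {1..N}" "sorted_by K N \<sigma>" "\<tau> permutes {1..N}" "sorted_by K N \<tau>"
  shows "\<sigma> = \<tau>"
proof -
  define r where "r a = card {b\<in>{1..N}. K b \<le> K a}" for a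
  have r: "r (\<rho> i) = i" if p: "\<rho> permutes {1..N}" "sorted_by K N \<rho>" "1 \<le> i" "i \<le> N" for \<rho> i
  proof -
    have "{b\<in>{1..N}. K b \<le> K (\<rho> i)} = \<rho> ` {1..i}"
    proof (intro set_eqI iffI)
      fix b assume b: "b \<in> {b\<in>{1..N}. K b \<le> K (\<rho> i)}"
      then obtain j where "1 \<le> j" "j \<le> N" "b = \<rho> j"
        using permutes_posE[OF p(1), of b] by auto
      with b p sorted_by_less[OF p(2), of i j] show "b \<in> \<rho> ` {1..i}" by force
    next
      fix b assume "b \<in> \<rho> ` {1..i}"
      then obtain j where "1 \<le> j" "j \<le> i" "b = \<rho> j" by auto
      with p permutes_mem[OF p(1), of j] sorted_by_less[OF p(2), of j i]
      show "b \<in> {b\<in>{1..N}. K b \<le> K (\<rho> i)}" by (cases "j = i") auto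
    qed
    moreover have "inj_on \<rho> {1..i}" by (rule permutes_inj_on[OF p(1)])
    ultimately show ?thesis by (simp add: r_def card_image)
  qed
  show ?thesis
  proof
    fix i
    show "\<sigma> i = \<tau> i"
    proof (cases "1 \<le> i \<and> i \<le> N")
      case True
      then obtain j where "1 \<le> j" "j \<le> N" "\<sigma> i = \<tau> j"
        using permutes_posE[OF assms(3)] permutes_mem[OF assms(1)] by metis
      with True r[OF assms(1,2), of i] r[OF assms(3,4), of j] show ?thesis by simp
    next
      case False
      then show ?thesis using assms by (auto simp: permutes_def)
    qed
  qed
qed

text \<open>A key that grows along the arcs of \<open>\<rho>\<close> leaves the sorted word no way
  to reverse one of them.\<close>

lemma sorted_by_arcs_eq:
  assumes "\<sigma> permutes {1..N}" "\<rho> permutes {1..N}" "sorted_by K N \<sigma>"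
    and K: "\<And>a b. (a, b) \<in> arcs N \<rho> \<Longrightarrow> K a < K b"
  shows "arcs N \<sigma> = arcs N \<rho>"
proof (rule arcs_subset_eq[OF assms(1,2)], rule subrelI)
  fix a b assume ab: "(a, b) \<in> arcs N \<sigma>"
  then have "K a < K b" by (auto elim!: arcsE intro: sorted_by_less[OF assms(3)])
  with K[of b a] arcs_total[OF assms(2) arcs_mem[OF ab assms(1)] arcs_edge[OF ab]]
  show "(a, b) \<in> arcs N \<rho>" by auto
qed

text \<open>Scheme for classes II and IV: among the permutations with the arcs of
  \<open>\<rho>\<close>, those in \<open>X\<close> are the sorted ones, and only one word is
  sorted.\<close>

lemma ex1_arcs_key:
  assumes "\<rho> permutes {1..N}" "inj_on K {1..N}"
    and "\<And>a b. (a, b) \<in> arcs N \<rho> \<Longrightarrow> K a < K b"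
    and "\<And>\<sigma>. \<sigma> \<in> X \<Longrightarrow> \<sigma> permutes {1..N}"
    and "\<And>\<sigma>. \<sigma> permutes {1..N} \<Longrightarrow> arcs N \<sigma> = arcs N \<rho> \<Longrightarrow> \<sigma> \<in> X \<Longrightarrow> sorted_by K N \<sigma>"
    and "\<And>\<sigma>. \<sigma> permutes {1..N} \<Longrightarrow> arcs N \<sigma> = arcs N \<rho> \<Longrightarrow> sorted_by K N \<sigma> \<Longrightarrow> \<sigma> \<in> X"
  shows "\<exists>!\<sigma>. \<sigma> \<in> X \<and> arcs N \<sigma> = arcs N \<rho>"
proof -
  obtain \<sigma> where \<sigma>: "\<sigma> permutes {1..N}" "sorted_by K N \<sigma>" using sorted_by_ex[OF assms(2)] by blast
  with sorted_by_arcs_eq[OF \<sigma>(1) assms(1) \<sigma>(2) assms(3)] assms(6) have "\<sigma> \<in> X \<and> arcs N \<sigma> = arcs N \<rho>"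
    by blast
  with assms(4,5) show ?thesis by (metis sorted_by_unique)
qed

text \<open>The number \<open>k * (N+1) + u\<close> encodes the pair \<open>(k, u)\<close>, which
  lets a key in the naturals combine a level with a tie-break.\<close>

lemma lex_less_iff:
  fixes k l u v N :: nat
  assumes "u \<le> N" "v \<le> N"
  shows "k * (N+1) + u < l * (N+1) + v \<longleftrightarrow> k < l \<or> k = l \<and> u < v"
proof -
  have "k * (N+1) + u < l * (N+1) + v" if "k < l" "u \<le> N" for k l u v
  proof -
    have "(k+1) * (N+1) \<le> l * (N+1)" using that(1) by (intro mult_right_mono) auto
    then show ?thesis using that(2) by (simp add: algebra_simps)
  qed
  with assms show ?thesis
    by (metis nat_neq_iff nat_add_left_cancel_less order_less_asym less_irrefl)
qed


lemma ex_last_before: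
  assumes "P k" "k < (m::nat)"
  obtains i where "k \<le> i" "i < m" "P i" "\<And>l. i < l \<Longrightarrow> l < m \<Longrightarrow> \<not> P l"
proof -
  let ?S = "{i. i < m \<and> P i}"
  have S: "finite ?S" "k \<in> ?S" using assms by auto
  then have "Max ?S \<in> ?S" by (intro Max_in) auto
  moreover have "i \<le> Max ?S" if "i < m" "P i" for i using S that by (intro Max_ge) auto
  ultimately show thesis using assms that[of "Max ?S"] by (metis (lifting) mem_Collect_eq not_less)
qed

section \<open>Levels\<close>

text \<open>
  Starting the chains at 1 in the odd letters and at 2 in the even ones makes the level of a
  letter congruent to the letter modulo 2.
\<close>

inductive chain :: "(nat \<times> nat) set \<Rightarrow> nat \<Rightarrow> nat \<Rightarrow> bool" for S where
  base: "chain S a (if odd a then 1 else 2)"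
| step: "chain S c k \<Longrightarrow> (c, a) \<in> S \<Longrightarrow> chain S a (Suc k)"

text \<open>The axioms refer to \<open>\<rho>\<close> through its arcs, so \<open>L\<close> serves
  every permutation with these arcs. A predecessor one level lower is promised above level 2 only,
  because a chain may start at 1 or 2.\<close>

locale levels =
  fixes N :: nat and \<rho> :: "nat \<Rightarrow> nat" and L :: "nat \<Rightarrow> nat"
  assumes perm: "\<rho> permutes {1..N}"
    and level_less: "(a, b) \<in> arcs N \<rho> \<Longrightarrow> L a < L b"
    and level_parity: "even (L a) \<longleftrightarrow> even a"
    and level_ge: "L a \<ge> 1"
    and level_pred: "L b > 2 \<Longrightarrow> \<exists>a. (a, b) \<in> arcs N \<rho> \<and> L b = Suc (L a)"

lemma ex_levels:
  assumes "\<sigma> permutes {1..N}"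
  shows "\<exists>L. levels N \<sigma> L"
proof -
  let ?S = "arcs N \<sigma>"
  \<comment> \<open>A chain moves to the right in \<open>\<sigma>\<close> at each step, which bounds
    its value and makes the greatest one exist; the 2 covers a start at an even letter.\<close>
  have bound: "k \<le> inv \<sigma> a + 2" if "chain ?S a k" for a k
    using that
  proof induction
    case (step c k a)
    then have "inv \<sigma> c < inv \<sigma> a"
      using arcs_inv[OF assms arcs_mem[OF step.hyps(2) assms]] by blast
    with step.IH show ?case by simp
  qed simp
  have par: "even k \<longleftrightarrow> even a" if "chain ?S a k" for a k
    using that by induction (auto dest!: arcs_edge simp: edge_def)
  define L where "L a = (GREATEST k. chain ?S a k)" for a
  have L: "chain ?S a (L a)" for a
    unfolding L_def by (rule GreatestI_nat[where P = "chain ?S a", OF chain.base], erule bound)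
  have le: "k \<le> L a" if "chain ?S a k" for a k
    unfolding L_def by (rule Greatest_le_nat[where P = "chain ?S a", OF that], erule bound)
  have "levels N \<sigma> L"
  proof
    show less: "L a < L b" if "(a, b) \<in> ?S" for a b
      using le[OF chain.step[OF L that]] by simp
    show "even (L a) \<longleftrightarrow> even a" for a by (rule par[OF L])
    show "L a \<ge> 1" for a using le[OF chain.base[of ?S a]] by (auto split: if_splits)
    show "\<exists>a. (a, b) \<in> ?S \<and> L b = Suc (L a)" if "L b > 2" for b
      using L[of b] that
    proof cases
      case (step c k)
      \<comment> \<open>\<open>k \<le> L c < L b = Suc k\<close> forces
        \<open>L c = k\<close>.\<close>
      with le[of c k] less[of c b] show ?thesis by (intro exI[of _ c]) auto
    qed (auto split: if_splits)
  qed (rule assms)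
  then show ?thesis by blast
qed

context levels
begin

lemma level_ge2: "even a \<Longrightarrow> L a \<ge> 2"
  using level_parity[of a] level_ge[of a] by (cases "L a = 1") auto

lemma pred_pos:
  assumes "arcs N \<sigma> = arcs N \<rho>" "\<sigma> permutes {1..N}" "L (\<sigma> j) > 2"
  obtains k where "1 \<le> k" "k < j" "edge (\<sigma> k) (\<sigma> j)" "L (\<sigma> j) = Suc (L (\<sigma> k))"
proof -
  obtain a where "(a, \<sigma> j) \<in> arcs N \<sigma>" "L (\<sigma> j) = Suc (L a)"
    using level_pred[OF assms(3)] assms(1) by auto
  then show thesis using that by (auto elim!: arcsE simp: permutes_eq_iff[OF assms(2)])
qed

lemma edge_level_less:
  assumes "arcs N \<sigma> = arcs N \<rho>" "1 \<le> i" "i < j" "j \<le> N" "edge (\<sigma> i) (\<sigma> j)"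
  shows "L (\<sigma> i) < L (\<sigma> j)"
  using arcsI[of i j N \<sigma>] assms level_less by simp

text \<open>A predecessor of the first letter is also one of the second.\<close>

lemma level_mono:
  assumes "arcs N \<sigma> = arcs N \<rho>" "\<sigma> permutes {1..N}" "1 \<le> i" "i < j" "j \<le> N"
    and "even (\<sigma> i) \<and> even (\<sigma> j) \<and> \<sigma> i < \<sigma> j \<or> odd (\<sigma> i) \<and> odd (\<sigma> j) \<and> \<sigma> j < \<sigma> i"
  shows "L (\<sigma> i) \<le> L (\<sigma> j)"
proof (cases "L (\<sigma> i) > 2")
  case True
  then obtain k where k: "1 \<le> k" "k < i" "edge (\<sigma> k) (\<sigma> i)" "L (\<sigma> i) = Suc (L (\<sigma> k))"
    using pred_pos[OF assms(1,2)] by blast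
  have "edge (\<sigma> k) (\<sigma> j)" using k(3) assms(6) by (auto simp: edge_def)
  then have "L (\<sigma> k) < L (\<sigma> j)" using edge_level_less[OF assms(1)] k assms by simp
  with k show ?thesis by simp
next
  case False
  show ?thesis
  proof (cases "even (\<sigma> i)")
    case True
    with False assms(6) level_ge2[of "\<sigma> j"] show ?thesis by auto
  next
    case odd: False
    with False level_parity[of "\<sigma> i"] level_ge[of "\<sigma> i"] have "L (\<sigma> i) = 1"
      by (cases "L (\<sigma> i) = 2") auto
    with level_ge[of "\<sigma> j"] show ?thesis by simp
  qed
qed

end

section \<open>Class II\<close>

lemma ex1_G_II:
  assumes "\<rho> permutes {1..2*n}"
  shows "\<exists>!\<sigma>. \<sigma> \<in> G_II n \<and> arcs (2*n) \<sigma> = arcs (2*n) \<rho>"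
proof -
  let ?N = "2*n"
  obtain L where "levels ?N \<rho> L" using ex_levels[OF assms] by blast
  then interpret levels ?N \<rho> L .
  \<comment> \<open>A level contains one parity only. Its letters increase if even and decrease if
    odd, as \<open>Ee\<close> and \<open>oO\<close> are forbidden.\<close>
  define K where "K a = L a * (?N+1) + (if even a then a else ?N - a)" for a
  have K: "K a < K b \<longleftrightarrow> L a < L b \<or> L a = L b \<and> (if even a then a < b else b < a)"
    if "a \<le> ?N" "b \<le> ?N" for a b
  proof -
    have "K a < K b \<longleftrightarrow>
        L a < L b \<or> L a = L b \<and> (if even a then a else ?N - a) < (if even b then b else ?N - b)"
      unfolding K_def using that by (intro lex_less_iff) auto
    moreover have "even a \<longleftrightarrow> even b" if "L a = L b" using level_parity that by metis
    ultimately show ?thesis using that by auto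
  qed
  show ?thesis
  proof (rule ex1_arcs_key[where K = K])
    show "inj_on K {1..?N}"
    proof (rule inj_onI)
      fix a b assume "a \<in> {1..?N}" "b \<in> {1..?N}" "K a = K b"
      then show "a = b" using K[of a b] K[of b a] level_parity[of a] level_parity[of b]
        by (auto split: if_splits)
    qed
    show "K a < K b" if "(a, b) \<in> arcs ?N \<rho>" for a b
      using K arcs_mem[OF that assms] level_less[OF that] by blast
    show "\<sigma> permutes {1..?N}" if "\<sigma> \<in> G_II n" for \<sigma> using that by (simp add: G_II_def)
  next
    fix \<sigma> assume \<sigma>: "\<sigma> permutes {1..?N}" "arcs ?N \<sigma> = arcs ?N \<rho>" "\<sigma> \<in> G_II n"
    show "sorted_by K ?N \<sigma>"
      unfolding sorted_by_def
    proof
      fix m assume m: "m \<in> {1..<?N}"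
      have pat: "\<not> desc_Ee \<sigma> m" "\<not> asc_eO \<sigma> m" "\<not> asc_oO \<sigma> m"
        "desc_Oe \<sigma> m \<Longrightarrow> k \<in> {1..m} \<Longrightarrow> odd (\<sigma> k)" for k
        using \<sigma>(3) m by (auto simp: G_II_def)
      have le: "\<sigma> m \<le> ?N" "\<sigma> (m+1) \<le> ?N"
        using permutes_mem[OF \<sigma>(1), of m] permutes_mem[OF \<sigma>(1), of "m+1"] m by auto
      have neq: "\<sigma> m \<noteq> \<sigma> (m+1)" using permutes_eq_iff[OF \<sigma>(1), of m "m+1"] by simp
      \<comment> \<open>Three of the eight parity patterns are forbidden, and two more are edges:
        the ascent from odd to even and the descent from even to odd.\<close>
      have "edge (\<sigma> m) (\<sigma> (m+1)) \<or> desc_Oe \<sigma> m \<or> asc_eE \<sigma> m \<or> desc_Oo \<sigma> m"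
        using pat(1-3) neq linorder_neqE_nat[of "\<sigma> m" "\<sigma> (m+1)"]
        unfolding edge_def desc_Ee_def asc_eO_def asc_oO_def desc_Oe_def asc_eE_def desc_Oo_def
        by meson
      then consider "edge (\<sigma> m) (\<sigma> (m+1))" | "desc_Oe \<sigma> m" | "asc_eE \<sigma> m" | "desc_Oo \<sigma> m"
        by blast
      then show "K (\<sigma> m) < K (\<sigma> (m+1))"
      proof cases
        case 1
        then show ?thesis using edge_level_less[OF \<sigma>(2), of m "m+1"] m K[OF le] by simp
      next
        case 2
        \<comment> \<open>Above level 2 the odd letter \<open>\<sigma> m\<close> would have an even
          predecessor to its left, where only odd letters stand.\<close>
        have "L (\<sigma> m) \<le> 2"
        proof (rule ccontr)
          assume "\<not> L (\<sigma> m) \<le> 2"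
          then obtain k where k: "1 \<le> k" "k < m" "edge (\<sigma> k) (\<sigma> m)"
            using pred_pos[OF \<sigma>(2,1)] by (metis not_less)
          with pat(4)[OF 2, of k] pat(4)[OF 2, of m] show False by (simp add: edge_def)
        qed
        with 2 have "L (\<sigma> m) < 2" using level_parity[of "\<sigma> m"]
          by (metis desc_Oe_def dvd_refl le_neq_implies_less)
        with 2 level_ge2[of "\<sigma> (m+1)"] K[OF le] show ?thesis by (auto simp: desc_Oe_def)
      next
        case 3
        then have "L (\<sigma> m) \<le> L (\<sigma> (m+1))"
          using level_mono[OF \<sigma>(2,1), of m "m+1"] m by (auto simp: asc_eE_def)
        with 3 K[OF le] show ?thesis by (auto simp: asc_eE_def)
      next
        case 4
        then have "L (\<sigma> m) \<le> L (\<sigma> (m+1))"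
          using level_mono[OF \<sigma>(2,1), of m "m+1"] m by (auto simp: desc_Oo_def)
        with 4 K[OF le] show ?thesis by (auto simp: desc_Oo_def)
      qed
    qed
  next
    fix \<sigma> assume \<sigma>: "\<sigma> permutes {1..?N}" "arcs ?N \<sigma> = arcs ?N \<rho>" "sorted_by K ?N \<sigma>"
    have ord: "L (\<sigma> i) < L (\<sigma> j) \<or> L (\<sigma> i) = L (\<sigma> j) \<and> (if even (\<sigma> i) then \<sigma> i < \<sigma> j else \<sigma> j < \<sigma> i)"
      if "1 \<le> i" "i < j" "j \<le> ?N" for i j
      using K[of "\<sigma> i" "\<sigma> j"] sorted_by_less[OF \<sigma>(3) that] that
        permutes_mem[OF \<sigma>(1), of i] permutes_mem[OF \<sigma>(1), of j] by simp
    \<comment> \<open>The predecessor realising the level of \<open>\<sigma> (m+1)\<close> need not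
      be adjacent, but sortedness squeezes \<open>\<sigma> m\<close> between the two.\<close>
    have pred: "\<exists>k. 1 \<le> k \<and> k \<le> m \<and> edge (\<sigma> k) (\<sigma> (m+1)) \<and> L (\<sigma> (m+1)) = Suc (L (\<sigma> k)) \<and>
        (L (\<sigma> k) < L (\<sigma> m) \<or> L (\<sigma> k) = L (\<sigma> m) \<and> (if even (\<sigma> k) then \<sigma> k \<le> \<sigma> m else \<sigma> m \<le> \<sigma> k))"
      if m: "m \<in> {1..<?N}" "L (\<sigma> (m+1)) > 2" for m
    proof -
      obtain k where k: "1 \<le> k" "k < m+1" "edge (\<sigma> k) (\<sigma> (m+1))" "L (\<sigma> (m+1)) = Suc (L (\<sigma> k))"
        using pred_pos[OF \<sigma>(2,1) m(2)] by blast
      with ord[of k m] m(1) show ?thesis by (intro exI[of _ k]) (cases "k = m", auto)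
    qed
    have par: "even (L (\<sigma> m)) \<longleftrightarrow> even (\<sigma> m)" for m by (rule level_parity)
    have "\<not> desc_Ee \<sigma> m \<and> \<not> asc_eO \<sigma> m \<and> \<not> asc_oO \<sigma> m \<and>
        (desc_Oe \<sigma> m \<longrightarrow> L (\<sigma> (m+1)) \<le> 2)" if m: "m \<in> {1..<?N}" for m
    proof (cases "L (\<sigma> (m+1)) > 2")
      case True
      from pred[OF m this] obtain k where k: "edge (\<sigma> k) (\<sigma> (m+1))" "L (\<sigma> (m+1)) = Suc (L (\<sigma> k))"
        "L (\<sigma> k) < L (\<sigma> m) \<or> L (\<sigma> k) = L (\<sigma> m) \<and> (if even (\<sigma> k) then \<sigma> k \<le> \<sigma> m else \<sigma> m \<le> \<sigma> k)"
        by blast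
      have "L (\<sigma> m) = L (\<sigma> k) \<or> L (\<sigma> m) = L (\<sigma> (m+1))"
        using ord[of m "m+1"] m k by auto
      then consider "L (\<sigma> m) = L (\<sigma> (m+1))" | "L (\<sigma> m) = L (\<sigma> k)" by blast
      then show ?thesis
      proof cases
        case 1
        then have "if even (\<sigma> m) then \<sigma> m < \<sigma> (m+1) else \<sigma> (m+1) < \<sigma> m"
          using ord[of m "m+1"] m by auto
        moreover have "even (\<sigma> m) \<longleftrightarrow> even (\<sigma> (m+1))" using par 1 by metis
        ultimately show ?thesis
          by (auto simp: desc_Ee_def asc_eO_def asc_oO_def desc_Oe_def split: if_splits)
      next
        \<comment> \<open>Being in the level of \<open>\<sigma> k\<close> and no earlier in it,
          \<open>\<sigma> m\<close> inherits the edge to \<open>\<sigma> (m+1)\<close>: even letters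
          of a level increase, odd ones decrease.\<close>
        case 2
        then have "if even (\<sigma> k) then \<sigma> k \<le> \<sigma> m else \<sigma> m \<le> \<sigma> k" using k(3) by auto
        moreover have "even (\<sigma> m) \<longleftrightarrow> even (\<sigma> k)" using par 2 by metis
        ultimately show ?thesis using k(1)
          by (auto simp: desc_Ee_def asc_eO_def asc_oO_def desc_Oe_def edge_def split: if_splits)
      qed
    next
      case False
      then have le: "L (\<sigma> (m+1)) \<le> 2" "L (\<sigma> m) \<ge> 1" using level_ge by auto
      have less: "L (\<sigma> m) < L (\<sigma> (m+1)) \<or> L (\<sigma> m) = L (\<sigma> (m+1)) \<and>
          (if even (\<sigma> m) then \<sigma> m < \<sigma> (m+1) else \<sigma> (m+1) < \<sigma> m)"
        using ord[of m "m+1"] m by simp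
      then consider "L (\<sigma> m) = 1" "L (\<sigma> (m+1)) = 2" | "L (\<sigma> m) = L (\<sigma> (m+1))"
        using le by linarith
      then show ?thesis
      proof cases
        case 1
        then show ?thesis using le par[of m] par[of "m+1"]
          by (simp add: desc_Ee_def asc_eO_def asc_oO_def)
      next
        case 2
        then have "even (\<sigma> m) \<longleftrightarrow> even (\<sigma> (m+1))" using par by metis
        then show ?thesis using less le 2
          by (auto simp: desc_Ee_def asc_eO_def asc_oO_def split: if_splits)
      qed
    qed
    note pat = this
    have "(\<forall>k\<in>{1..m}. odd (\<sigma> k)) \<and> (\<forall>k\<in>{1..<m}. \<sigma> k > \<sigma> (k+1))"
      if m: "m \<in> {1..<?N}" "desc_Oe \<sigma> m" for m
    proof -
      \<comment> \<open>By \<open>pat\<close> the even letter of an \<open>Oe\<close> has level 2,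
        so the odd one has level 1, and so has every letter before it.\<close>
      have "L (\<sigma> m) < 2"
        using pat[OF m(1)] m ord[of m "m+1"] par[of m] par[of "m+1"] by (auto simp: desc_Oe_def)
      then have one: "L (\<sigma> k) = 1" if "k \<in> {1..m}" for k
        using ord[of k m] m that level_ge[of "\<sigma> k"] by (cases "k = m") auto
      then have "odd (\<sigma> k)" if "k \<in> {1..m}" for k using par[of k] that by simp
      moreover have "\<sigma> k > \<sigma> (k+1)" if "k \<in> {1..<m}" for k
        using ord[of k "k+1"] one[of k] one[of "k+1"] calculation[of k] m that by auto
      ultimately show ?thesis by blast
    qed
    with pat \<sigma>(1) show "\<sigma> \<in> G_II n" unfolding G_II_def by blast
  qed (rule assms)
qed

section \<open>Class III\<close>

text \<open>
  Class III consists of the lexicographic normal forms: the odd letters come first in increasing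
  order, then the even letters in decreasing order.
\<close>

definition precedes :: "nat \<Rightarrow> nat \<Rightarrow> bool" where
  "precedes a b \<longleftrightarrow> (if odd a then even b \<or> a < b else even b \<and> b < a)"

lemma precedes_total: "a \<noteq> b \<Longrightarrow> precedes a b \<or> precedes b a"
  by (auto simp: precedes_def)

lemma precedes_trans: "precedes a b \<Longrightarrow> precedes b c \<Longrightarrow> precedes a c"
  by (auto simp: precedes_def split: if_splits)

lemma precedes_irrefl: "\<not> precedes a a"
  by (simp add: precedes_def)

section \<open>Lexicographic order on words\<close>

definition lex_less :: "(nat \<Rightarrow> nat) \<Rightarrow> (nat \<Rightarrow> nat) \<Rightarrow> bool" where
  "lex_less \<sigma> \<tau> \<longleftrightarrow> (\<exists>m. (\<forall>k<m. \<sigma> k = \<tau> k) \<and> precedes (\<sigma> m) (\<tau> m))"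

lemma lex_less_trans:
  assumes "lex_less \<sigma> \<tau>" "lex_less \<tau> \<upsilon>"
  shows "lex_less \<sigma> \<upsilon>"
proof -
  obtain k l where k: "\<And>i. i < k \<Longrightarrow> \<sigma> i = \<tau> i" "precedes (\<sigma> k) (\<tau> k)"
    and l: "\<And>i. i < l \<Longrightarrow> \<tau> i = \<upsilon> i" "precedes (\<tau> l) (\<upsilon> l)"
    using assms unfolding lex_less_def by blast
  have "precedes (\<sigma> (min k l)) (\<upsilon> (min k l))"
    using k l precedes_trans[of "\<sigma> k" "\<tau> k" "\<upsilon> k"]
    by (cases k l rule: linorder_cases) (auto simp: min_def)
  with k l show ?thesis unfolding lex_less_def by (intro exI[of _ "min k l"]) simp
qed

lemma finite_lex_minimal:
  assumes "finite A" "A \<noteq> {}"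
  obtains \<sigma> where "\<sigma> \<in> A" "\<And>\<tau>. \<tau> \<in> A \<Longrightarrow> \<not> lex_less \<tau> \<sigma>"
proof -
  have "\<exists>\<sigma>\<in>A. \<forall>\<tau>\<in>A. \<not> lex_less \<tau> \<sigma>"
    using assms
  proof (induction rule: finite_ne_induct)
    case (singleton \<sigma>)
    then show ?case by (auto simp: lex_less_def precedes_irrefl)
  next
    case (insert \<upsilon> A)
    then obtain \<sigma> where \<sigma>: "\<sigma> \<in> A" "\<And>\<tau>. \<tau> \<in> A \<Longrightarrow> \<not> lex_less \<tau> \<sigma>" by blast
    have irr: "\<not> lex_less \<upsilon> \<upsilon>" by (simp add: lex_less_def precedes_irrefl)
    show ?case
    proof (cases "lex_less \<upsilon> \<sigma>")
      case True
      with \<sigma> irr lex_less_trans[OF _ True] show ?thesis by (intro bexI[of _ \<upsilon>]) auto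
    next
      case False
      with \<sigma> show ?thesis by (intro bexI[of _ \<sigma>]) auto
    qed
  qed
  with that show thesis by blast
qed

text \<open>Commuting a letter to the left past letters with which it shares no edge reverses no
  arc.\<close>

lemma move_front:
  assumes \<sigma>: "\<sigma> permutes {1..N}" and ij: "1 \<le> i" "i < j" "j \<le> N"
    and comm: "\<And>l. i \<le> l \<Longrightarrow> l < j \<Longrightarrow> \<not> edge (\<sigma> l) (\<sigma> j)"
  obtains \<tau> where "\<tau> permutes {1..N}" "arcs N \<tau> = arcs N \<sigma>" "\<And>k. k < i \<Longrightarrow> \<tau> k = \<sigma> k" "\<tau> i = \<sigma> j"
proof -
  \<comment> \<open>\<open>c\<close> rotates the positions from \<open>i\<close> to
    \<open>j\<close>: the \<open>j\<close>-th letter goes to position \<open>i\<close>, the others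
    one place to the right.\<close>
  define c where "c k = (if k = i then j else if i < k \<and> k \<le> j then k - 1 else k)" for k
  have "inj c" using ij by (auto simp: inj_def c_def split: if_splits)
  then have inj: "inj_on c {1..N}" by (rule inj_on_subset) simp
  have "c k \<in> {1..N}" if "k \<in> {1..N}" for k using that ij by (auto simp: c_def)
  then have "c ` {1..N} \<subseteq> {1..N}" by blast
  with inj have "bij_betw c {1..N} {1..N}" by (simp add: bij_betw_def endo_inj_surj)
  then have c: "c permutes {1..N}"
    by (rule bij_imp_permutes) (use ij in \<open>auto simp: c_def\<close>)
  have p: "(\<sigma> \<circ> c) permutes {1..N}" by (rule permutes_compose[OF c \<sigma>])
  have "arcs N (\<sigma> \<circ> c) \<subseteq> arcs N \<sigma>"
  proof (rule subrelI)
    fix a b assume "(a, b) \<in> arcs N (\<sigma> \<circ> c)"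
    then obtain k l where kl: "a = \<sigma> (c k)" "b = \<sigma> (c l)" "1 \<le> k" "k < l" "l \<le> N" "edge a b"
      by (auto elim: arcsE)
    have "c k < c l"
    proof (rule ccontr)
      assume "\<not> c k < c l"
      then have "k = i" "i < l" "l \<le> j" using kl(4) ij by (auto simp: c_def split: if_splits)
      then have "\<not> edge b a" using kl(1,2) ij comm[of "l - 1"] by (auto simp: c_def)
      with kl(6) show False using edge_sym by blast
    qed
    moreover have "1 \<le> c k" "c l \<le> N" using permutes_mem[OF c] kl(3-5) by auto
    ultimately show "(a, b) \<in> arcs N \<sigma>" using kl by (auto intro: arcsI)
  qed
  from arcs_subset_eq[OF p \<sigma> this] p show thesis
    by (intro that[of "\<sigma> \<circ> c"]) (auto simp: c_def)
qed

text \<open>Let \<open>\<tau> m\<close> be the last letter before \<open>\<tau> j\<close> that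
  \<open>\<tau> j\<close> should precede. All letters between them precede \<open>\<tau> j\<close>,
  and this forces an \<open>Oo\<close>, an \<open>eE\<close> or some \<open>eO_d\<close> starting at
  \<open>m\<close>.\<close>

lemma G_III_no_factor:
  assumes \<tau>: "\<tau> \<in> G_III n" and ij: "1 \<le> i" "i < j" "j \<le> 2*n"
    and comm: "\<And>l. i \<le> l \<Longrightarrow> l < j \<Longrightarrow> \<not> edge (\<tau> l) (\<tau> j)"
  shows "\<not> precedes (\<tau> j) (\<tau> i)"
proof
  assume "precedes (\<tau> j) (\<tau> i)"
  have p: "\<tau> permutes {1..2*n}" using \<tau> by (simp add: G_III_def)
  have neq: "\<tau> k \<noteq> \<tau> l" if "k \<noteq> l" for k l using permutes_eq_iff[OF p, of k l] that by simp
  obtain m where m: "i \<le> m" "m < j" "precedes (\<tau> j) (\<tau> m)" "\<And>l. m < l \<Longrightarrow> l < j \<Longrightarrow> \<not> precedes (\<tau> j) (\<tau> l)"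
    using ex_last_before[where P = "\<lambda>l. precedes (\<tau> j) (\<tau> l)", OF \<open>precedes (\<tau> j) (\<tau> i)\<close> ij(2)] by blast
  have Oo: "\<not> desc_Oo \<tau> m" and eE: "\<not> asc_eE \<tau> m"
    using \<tau> m ij by (auto simp: G_III_def)
  have eO: "\<not> dist_eO d \<tau> m k" if "m < k" "k \<le> j" for d k
    using \<tau> m ij that by (auto simp: G_III_def)
  have pj: "precedes (\<tau> l) (\<tau> j)" if "m < l" "l < j" for l
    using precedes_total[OF neq[of l j]] m(4)[OF that] that by auto
  have next_le: "\<tau> (m+1) = \<tau> j \<or> precedes (\<tau> (m+1)) (\<tau> j)" using pj[of "m+1"] m(2) by (cases "m + 1 = j") auto
  have comm_m: "\<not> edge (\<tau> m) (\<tau> j)" using comm m by simp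
  show False
  proof (cases "odd (\<tau> j)")
    case True
    \<comment> \<open>Only odd letters precede an odd letter.\<close>
    have o: "odd (\<tau> l)" if "m < l" "l \<le> j" for l
      using pj[of l] that True by (cases "l = j") (auto simp: precedes_def split: if_splits)
    show False
    proof (cases "odd (\<tau> m)")
      case odd: True
      then have "\<tau> j < \<tau> m" using m(3) True by (simp add: precedes_def)
      then show False using Oo odd o[of "m+1"] m(2) next_le True
        by (auto simp: desc_Oo_def precedes_def)
    next
      case False
      then have "\<tau> m < \<tau> j" using comm_m True neq[of m j] m(2) by (auto simp: edge_def)
      then have "dist_eO (j - m - 1) \<tau> m j" using False o m(2) by (auto simp: dist_eO_def)
      with eO[of j] m(2) show False by blast
    qed
  next
    case False
    then have em: "even (\<tau> m)" "\<tau> m < \<tau> j" using m(3) by (auto simp: precedes_def)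
    show False
    proof (cases "even (\<tau> (m+1))")
      case True
      \<comment> \<open>The next letter is even and at least \<open>\<tau> j\<close>, hence larger
        than \<open>\<tau> m\<close>.\<close>
      then show False using eE em next_le False by (auto simp: asc_eE_def precedes_def)
    next
      case odd: False
      then have "m + 1 < j" using m(2) False by (cases "m + 1 = j") auto
      then have "\<not> edge (\<tau> (m+1)) (\<tau> j)" using comm[of "m+1"] m(1) by simp
      then have "\<tau> j < \<tau> (m+1)" using odd False neq[of "m+1" j] \<open>m + 1 < j\<close> by (auto simp: edge_def)
      then have "dist_eO 0 \<tau> m (m+1)" using em odd by (auto simp: dist_eO_def le_Suc_eq)
      with eO[of "m+1"] \<open>m + 1 < j\<close> show False by auto
    qed
  qed
qed

text \<open>At the first difference, the preceding one of the two letters occurs later in the other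
  word and could be commuted back to this position there: an edge in its way would be oriented
  oppositely in the two words.\<close>

lemma G_III_arcs_unique:
  assumes "\<sigma> \<in> G_III n" "\<tau> \<in> G_III n" "arcs (2*n) \<sigma> = arcs (2*n) \<tau>"
  shows "\<sigma> = \<tau>"
proof (rule ccontr)
  assume "\<sigma> \<noteq> \<tau>"
  have p: "\<sigma> permutes {1..2*n}" "\<tau> permutes {1..2*n}" using assms by (auto simp: G_III_def)
  define m where "m = (LEAST k. \<sigma> k \<noteq> \<tau> k)"
  have "\<exists>k. \<sigma> k \<noteq> \<tau> k" using \<open>\<sigma> \<noteq> \<tau>\<close> by auto
  then have m: "\<sigma> m \<noteq> \<tau> m" unfolding m_def by (rule LeastI_ex)
  have eq: "\<sigma> k = \<tau> k" if "k < m" for k using not_less_Least[OF that[unfolded m_def]] by simp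
  have mN: "1 \<le> m" "m \<le> 2*n" using m p by (auto simp: permutes_def Suc_le_eq intro: ccontr) 
  have False if "precedes (\<alpha> m) (\<beta> m)" "\<alpha> \<in> G_III n" "\<beta> \<in> G_III n" "arcs (2*n) \<alpha> = arcs (2*n) \<beta>"
    "\<And>k. k < m \<Longrightarrow> \<alpha> k = \<beta> k" for \<alpha> \<beta>
  proof -
    have q: "\<alpha> permutes {1..2*n}" "\<beta> permutes {1..2*n}" using that by (auto simp: G_III_def)
    obtain j where j: "1 \<le> j" "j \<le> 2*n" "\<alpha> m = \<beta> j"
      using permutes_posE[OF q(2)] permutes_mem[OF q(1) mN] by blast
    have "j \<noteq> m" using j(3) that(1) precedes_irrefl by metis
    moreover have "\<not> j < m" using that(5)[of j] j(3) permutes_eq_iff[OF q(1), of m j] by auto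
    ultimately have "m < j" by simp
    have "\<not> edge (\<beta> l) (\<beta> j)" if l: "m \<le> l" "l < j" for l
    proof
      assume e: "edge (\<beta> l) (\<beta> j)"
      then have b: "(\<beta> l, \<beta> j) \<in> arcs (2*n) \<beta>" using l j mN by (auto intro: arcsI)
      obtain k where k: "1 \<le> k" "k \<le> 2*n" "\<beta> l = \<alpha> k"
        using permutes_posE[OF q(1)] permutes_mem[OF q(2), of l] l j mN by (metis le_trans less_imp_le)
      have "k \<noteq> m" using k(3) j(3) l(2) permutes_eq_iff[OF q(2), of l j] by auto
      moreover have "\<not> k < m" using \<open>\<And>k. k < m \<Longrightarrow> \<alpha> k = \<beta> k\<close>[of k] k(3) l(1) permutes_eq_iff[OF q(2), of l k] by auto
      ultimately have "(\<alpha> m, \<alpha> k) \<in> arcs (2*n) \<alpha>"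
        using e k j mN edge_sym by (intro arcsI) auto
      with b arcs_antisym[OF b q(2)] \<open>arcs (2*n) \<alpha> = arcs (2*n) \<beta>\<close> k j show False by simp
    qed
    from G_III_no_factor[OF \<open>\<beta> \<in> G_III n\<close> mN(1) \<open>m < j\<close> j(2) this] that(1) j(3) show False by simp
  qed
  note clash = this
  from precedes_total[OF m] show False
  proof
    assume "precedes (\<sigma> m) (\<tau> m)"
    from clash[OF this assms eq] show False .
  next
    assume "precedes (\<tau> m) (\<sigma> m)"
    from clash[OF this assms(2,1) assms(3)[symmetric] eq[symmetric]] show False .
  qed
qed

text \<open>The lexicographically least word with the given arcs lies in the class, because each
  forbidden pattern would allow \<open>move_front\<close> to produce a smaller word.\<close>

lemma ex1_G_III:
  assumes "\<rho> permutes {1..2*n}"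
  shows "\<exists>!\<sigma>. \<sigma> \<in> G_III n \<and> arcs (2*n) \<sigma> = arcs (2*n) \<rho>"
proof -
  let ?N = "2*n"
  let ?A = "{\<sigma>. \<sigma> permutes {1..?N} \<and> arcs ?N \<sigma> = arcs ?N \<rho>}"
  have "finite ?A" by (rule finite_subset[OF _ finite_permutations[of "{1..?N}"]]) auto
  moreover have "?A \<noteq> {}" using assms by blast
  ultimately obtain \<sigma> where \<sigma>: "\<sigma> permutes {1..?N}" "arcs ?N \<sigma> = arcs ?N \<rho>"
      "\<And>\<tau>. \<tau> \<in> ?A \<Longrightarrow> \<not> lex_less \<tau> \<sigma>"
    by (rule finite_lex_minimal) blast
  have no_factor: "\<not> precedes (\<sigma> j) (\<sigma> i)"
    if ij: "1 \<le> i" "i < j" "j \<le> ?N" "\<And>l. i \<le> l \<Longrightarrow> l < j \<Longrightarrow> \<not> edge (\<sigma> l) (\<sigma> j)" for i j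
  proof
    assume pr: "precedes (\<sigma> j) (\<sigma> i)"
    obtain \<tau> where \<tau>: "\<tau> permutes {1..?N}" "arcs ?N \<tau> = arcs ?N \<sigma>" "\<And>k. k < i \<Longrightarrow> \<tau> k = \<sigma> k" "\<tau> i = \<sigma> j"
      using move_front[OF \<sigma>(1) ij] by blast
    then have "lex_less \<tau> \<sigma>" unfolding lex_less_def using pr by (intro exI[of _ i]) auto
    with \<sigma>(2,3) \<tau> show False by auto
  qed
  have adj: "\<not> precedes (\<sigma> (m+1)) (\<sigma> m)" if "m \<in> {1..<?N}" "\<not> edge (\<sigma> m) (\<sigma> (m+1))" for m
  proof (rule no_factor)
    fix l assume "m \<le> l" "l < m + 1"
    then have "l = m" by simp
    with that show "\<not> edge (\<sigma> l) (\<sigma> (m+1))" by simp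
  qed (use that in auto)
  have "\<not> desc_Oo \<sigma> m \<and> \<not> asc_eE \<sigma> m" if "m \<in> {1..<?N}" for m
    using adj[OF that] by (auto simp: desc_Oo_def asc_eE_def edge_def precedes_def)
  moreover have "\<not> dist_eO d \<sigma> i j" if "i \<in> {1..?N}" "j \<in> {1..?N}" for d i j
  proof
    assume D: "dist_eO d \<sigma> i j"
    then have ij: "i < j" "even (\<sigma> i)" "\<sigma> i < \<sigma> j" "\<And>l. i < l \<Longrightarrow> l \<le> j \<Longrightarrow> odd (\<sigma> l)"
      by (auto simp: dist_eO_def)
    \<comment> \<open>The even \<open>\<sigma> i\<close> is below the odd \<open>\<sigma> j\<close>,
      and all letters between them are odd.\<close>
    have "\<not> edge (\<sigma> l) (\<sigma> j)" if "i \<le> l" "l < j" for l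
      using ij(2,3) ij(4)[of l] ij(4)[of j] that by (cases "l = i") (auto simp: edge_def)
    then have "\<not> precedes (\<sigma> j) (\<sigma> i)" using no_factor[of i j] that ij(1) by auto
    with ij(1,2) ij(4)[of j] show False by (simp add: precedes_def)
  qed
  ultimately have "\<sigma> \<in> G_III n" using \<sigma>(1) by (auto simp: G_III_def)
  with \<sigma>(2) show ?thesis using G_III_arcs_unique by metis
qed

section \<open>Class IV\<close>

text \<open>The assumption \<open>two\<close> provides an even letter, so that
  \<open>top_level\<close> is the maximum of a nonempty set.\<close>

locale placement = levels +
  assumes two: "2 \<le> N"
begin

definition top_level :: nat where
  "top_level = Max (L ` {a\<in>{1..N}. even a})"

definition succs :: "nat \<Rightarrow> nat set" where
  "succs x = {y. (x, y) \<in> arcs N \<rho>}"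

text \<open>Whether a new odd block has to be opened after the evens of top level.\<close>

definition overflow :: bool where
  "overflow \<longleftrightarrow> (\<exists>z w. (z, w) \<in> arcs N \<rho> \<and> L z = top_level \<and> succs w = {})"

text \<open>Even letters are placed as early as possible, odd letters as late as possible.\<close>

definition place :: "nat \<Rightarrow> nat" where
  "place x = (if even x then L x else if succs x \<noteq> {} then Min (L ` succs x) - 1
     else if overflow then top_level + 1 else top_level - 1)"

lemma level_le_top: "even a \<Longrightarrow> 1 \<le> a \<Longrightarrow> a \<le> N \<Longrightarrow> L a \<le> top_level"
  unfolding top_level_def by (rule Max_ge) auto

lemma top_levelE:
  obtains a where "1 \<le> a" "a \<le> N" "even a" "L a = top_level"
proof -
  have "2 \<in> {a\<in>{1..N}. even a}" using two by simp
  then have "top_level \<in> L ` {a\<in>{1..N}. even a}"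
    unfolding top_level_def by (intro Max_in) auto
  then show thesis using that by auto
qed

lemma even_top_level: "even top_level" and top_level_ge2: "2 \<le> top_level"
  by (rule top_levelE, use level_parity in metis) (rule top_levelE, use level_ge2 in metis)

lemma succs_fin: "finite (succs x)"
proof (rule finite_subset)
  show "succs x \<subseteq> {1..N}" using arcs_mem[OF _ perm] by (auto simp: succs_def)
qed simp

lemma succs_even: "odd x \<Longrightarrow> y \<in> succs x \<Longrightarrow> even y"
  by (auto simp: succs_def edge_def dest!: arcs_edge)

lemma place_even [simp]: "even a \<Longrightarrow> place a = L a"
  by (simp add: place_def)

lemma place_succE:
  assumes "odd x" "succs x \<noteq> {}"
  obtains y where "(x, y) \<in> arcs N \<rho>" "L y = Suc (place x)"
proof -
  have "Min (L ` succs x) \<in> L ` succs x" using assms succs_fin by (intro Min_in) auto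
  then obtain y where y: "y \<in> succs x" "L y = Min (L ` succs x)" by auto
  with assms have "L y = Suc (place x)"
    using level_ge2[OF succs_even[OF assms(1) y(1)]] by (simp add: place_def)
  with y that show thesis by (auto simp: succs_def)
qed

lemma place_less_succ:
  assumes "(x, y) \<in> arcs N \<rho>" "odd x"
  shows "place x < L y"
proof -
  have y: "y \<in> succs x" using assms by (simp add: succs_def)
  then have "Min (L ` succs x) \<le> L y" using succs_fin by (intro Min_le) auto
  \<comment> \<open>This makes the truncated subtraction in \<open>place\<close> exact.\<close>
  moreover have "2 \<le> L y" by (rule level_ge2[OF succs_even[OF assms(2) y]])
  ultimately show ?thesis using y assms(2) by (auto simp: place_def)
qed

lemma place_nosucc:
  "odd x \<Longrightarrow> succs x = {} \<Longrightarrow> place x = (if overflow then top_level + 1 else top_level - 1)"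
  by (simp add: place_def)

lemma place_le:
  assumes "odd x"
  shows "place x \<le> (if overflow then top_level + 1 else top_level - 1)"
proof (cases "succs x = {}")
  case False
  then obtain y where y: "(x, y) \<in> arcs N \<rho>" "L y = Suc (place x)"
    by (rule place_succE[OF assms])
  then have "even y" using succs_even[OF assms] by (simp add: succs_def)
  with y level_le_top[of y] arcs_mem[OF y(1) perm] show ?thesis by auto
qed (simp add: place_nosucc assms)

lemma place_parity: "even (place x) \<longleftrightarrow> even x"
proof (cases "even x \<or> succs x = {}")
  case True
  then show ?thesis
    using level_parity[of x] place_nosucc[of x] even_top_level top_level_ge2
    by (cases "even x"; cases overflow) auto
next
  case False
  then obtain y where y: "(x, y) \<in> arcs N \<rho>" "L y = Suc (place x)"
    using place_succE by blast
  then have "even y" using succs_even[of x y] False by (simp add: succs_def)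
  with y level_parity[of y] False show ?thesis by simp
qed

text \<open>On an arc from an even \<open>a\<close> to an odd \<open>b\<close>, every successor of
  \<open>b\<close> lies at least two levels above \<open>a\<close>. If \<open>b\<close> has no
  successor, an arc out of the top level is what triggers \<open>overflow\<close>.\<close>

lemma place_less:
  assumes "(a, b) \<in> arcs N \<rho>"
  shows "place a < place b"
proof (cases "odd a")
  case True
  with assms place_less_succ[OF assms] show ?thesis
    using succs_even[OF True, of b] by (simp add: succs_def)
next
  case a: False
  then have b: "odd b" using arcs_edge[OF assms] by (auto simp: edge_def)
  show ?thesis
  proof (cases "succs b = {}")
    case True
    have "L a \<le> top_level" using level_le_top a arcs_mem[OF assms perm] by simp
    moreover have "L a \<noteq> top_level" if "\<not> overflow"
      using that True assms by (auto simp: overflow_def)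
    \<comment> \<open>Parity leaves \<open>L a \<le> top_level - 2\<close> when there is no
      overflow.\<close>
    moreover have "L a \<noteq> top_level - 1"
      using level_parity[of a] a even_top_level top_level_ge2 by auto
    ultimately show ?thesis using True a b by (auto simp: place_nosucc)
  next
    case False
    then obtain y where y: "(b, y) \<in> arcs N \<rho>" "L y = Suc (place b)"
      by (rule place_succE[OF b])
    with level_less[OF assms] level_less[OF y(1)] a show ?thesis by simp
  qed
qed

lemma level_le_place:
  assumes "odd c" "(c, b) \<in> arcs N \<rho>"
  shows "L c \<le> place c"
proof -
  have "succs c \<noteq> {}" using assms(2) by (auto simp: succs_def)
  then obtain y where "(c, y) \<in> arcs N \<rho>" "L y = Suc (place c)" by (rule place_succE[OF assms(1)])
  with level_less[of c y] show ?thesis by simp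
qed

text \<open>A predecessor that realises the level of \<open>b\<close> has no room to move right:
  \<open>L c \<le> place c < L b = Suc (L c)\<close>.\<close>

lemma even_predE:
  assumes "even b" "L b > 2"
  obtains c where "odd c" "(c, b) \<in> arcs N \<rho>" "L b = Suc (L c)" "place c = L c"
proof -
  obtain c where c: "(c, b) \<in> arcs N \<rho>" "L b = Suc (L c)" using level_pred[OF assms(2)] by blast
  then have "odd c" using level_parity[of c] level_parity[of b] assms by auto
  with c level_le_place[of c b] place_less_succ[of c b] that show thesis by auto
qed

text \<open>The arc enters the block of \<open>b\<close>, not necessarily \<open>b\<close> itself.
  One arc between consecutive blocks suffices to exclude \<open>eO\<close> at their border, where
  the largest even letter meets the smallest odd one.\<close>

lemma odd_predE:
  assumes "odd b" "place b > 2"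
  obtains c d where "(d, c) \<in> arcs N \<rho>" "odd c" "even d" "place c = place b" "place b = Suc (L d)"
proof -
  note res = that
  \<comment> \<open>Going back twice from a letter just above the block, along predecessors that
    realise the levels, yields first \<open>c\<close> in the block and then
    \<open>d\<close>.\<close>
  have *: thesis if "even y" "L y = Suc (place b)" for y
  proof -
    from that assms(2) have "L y > 2" by simp
    then obtain c where c: "odd c" "L y = Suc (L c)" "place c = L c"
      by (rule even_predE[OF \<open>even y\<close>]) blast
    with that assms(2) have "L c > 2" by simp
    then obtain d where d: "(d, c) \<in> arcs N \<rho>" "L c = Suc (L d)" using level_pred by blast
    then have "even d" using c arcs_edge[OF d(1)] by (auto simp: edge_def)
    with c d \<open>L y = Suc (place b)\<close> show thesis using res[of d c] by auto
  qed
  show thesis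
  proof (cases "succs b = {}")
    case False
    then obtain y where "(b, y) \<in> arcs N \<rho>" "L y = Suc (place b)" by (rule place_succE[OF assms(1)])
    with succs_even[OF assms(1), of y] show thesis by (intro *[of y]) (auto simp: succs_def)
  next
    case True
    show thesis
    proof (cases overflow)
      case ov: True
      then obtain z w where zw: "(z, w) \<in> arcs N \<rho>" "L z = top_level" "succs w = {}"
        by (auto simp: overflow_def)
      then have "even z" using level_parity[of z] even_top_level by simp
      moreover from this have "odd w" using arcs_edge[OF zw(1)] by (auto simp: edge_def)
      ultimately show thesis
        using zw True ov assms(1) that[of z w] by (simp add: place_nosucc)
    next
      case False
      obtain a where "even a" "L a = top_level" by (rule top_levelE) blast
      with False True top_level_ge2 assms(1) show thesis by (intro *[of a]) (auto simp: place_nosucc)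
    qed
  qed
qed

end

section \<open>Class IV as the words sorted by place\<close>

lemma ex1_G_IV:
  assumes "1 \<le> n" "\<rho> permutes {1..2*n}"
  shows "\<exists>!\<sigma>. \<sigma> \<in> G_IV n \<and> arcs (2*n) \<sigma> = arcs (2*n) \<rho>"
proof -
  let ?N = "2*n"
  obtain L where "levels ?N \<rho> L" using ex_levels[OF assms(2)] by blast
  then interpret placement ?N \<rho> L
    using assms(1) by (simp add: placement_def placement_axioms_def)
  \<comment> \<open>Letters of either parity increase inside a block, since \<open>Oo_0\<close> and
    \<open>Ee_0\<close> forbid descents between neighbours of equal parity.\<close>
  define K where "K a = place a * (?N+1) + a" for a
  have K: "K a < K b \<longleftrightarrow> place a < place b \<or> place a = place b \<and> a < b"
    if "a \<le> ?N" "b \<le> ?N" for a b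
    unfolding K_def using that by (intro lex_less_iff) auto
  show ?thesis
  proof (rule ex1_arcs_key[where K = K])
    show "inj_on K {1..?N}"
    proof (rule inj_onI)
      fix a b assume "a \<in> {1..?N}" "b \<in> {1..?N}" "K a = K b"
      then show "a = b" using K[of a b] K[of b a] by auto
    qed
    show "K a < K b" if "(a, b) \<in> arcs ?N \<rho>" for a b
      using K arcs_mem[OF that assms(2)] place_less[OF that] by blast
    show "\<sigma> permutes {1..?N}" if "\<sigma> \<in> G_IV n" for \<sigma> using that by (simp add: G_IV_def)
  next
    fix \<sigma> assume \<sigma>: "\<sigma> permutes {1..?N}" "arcs ?N \<sigma> = arcs ?N \<rho>" "\<sigma> \<in> G_IV n"
    have neq: "\<sigma> i \<noteq> \<sigma> j" if "i \<noteq> j" for i j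
      using permutes_eq_iff[OF \<sigma>(1), of i j] that by simp
    have eO: "\<sigma> (m+1) < \<sigma> m" if "1 \<le> m" "m < ?N" "even (\<sigma> m)" "odd (\<sigma> (m+1))" for m
    proof -
      have "\<not> asc_eO \<sigma> m" using \<sigma>(3) that by (auto simp: G_IV_def)
      with that neq[of m "m+1"] show ?thesis by (simp add: asc_eO_def)
    qed
    have pat: "\<not> dist_Oo d \<sigma> i j" "\<not> dist_Ee d \<sigma> i j" if "1 \<le> i" "i < j" "j \<le> ?N" for d i j
      using \<sigma>(3) that by (auto simp: G_IV_def)
    have ee: "\<sigma> m < \<sigma> (m+1)" if "1 \<le> m" "m < ?N" "even (\<sigma> m)" "even (\<sigma> (m+1))" for m
      using pat(2)[of m "m+1" 0] that neq[of m "m+1"] by (auto simp: dist_Ee_def)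
    have oo: "\<sigma> m < \<sigma> (m+1)" if "1 \<le> m" "m < ?N" "odd (\<sigma> m)" "odd (\<sigma> (m+1))" for m
      using pat(1)[of m "m+1" 0] that neq[of m "m+1"] by (auto simp: dist_Oo_def)
    have edge_less: "L (\<sigma> i) < L (\<sigma> j)" if "1 \<le> i" "i < j" "j \<le> ?N" "edge (\<sigma> i) (\<sigma> j)" for i j
      by (rule edge_level_less[OF \<sigma>(2) that])
    \<comment> \<open>The least odd letter in between has an edge to both ends: the absence of
      \<open>eO\<close> puts it below \<open>\<sigma> i\<close>, and then that of
      \<open>Ee_d\<close> puts it below \<open>\<sigma> j\<close>.\<close>
    have gap: "L (\<sigma> i) + 2 \<le> L (\<sigma> j)"
      if ij: "1 \<le> i" "i + 1 < j" "j \<le> ?N" "even (\<sigma> i)" "even (\<sigma> j)" "\<And>l. i < l \<Longrightarrow> l < j \<Longrightarrow> odd (\<sigma> l)"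
      for i j
    proof -
      have ne: "\<sigma> ` {i<..<j} \<noteq> {}" "finite (\<sigma> ` {i<..<j})" using ij(2) by auto
      obtain l where l: "i < l" "l < j" "\<sigma> l = Min (\<sigma> ` {i<..<j})" using Min_in[OF ne(2,1)] by auto
      have "\<sigma> l \<le> \<sigma> (i+1)" using l(3) Min_le[OF ne(2), of "\<sigma> (i+1)"] ij(2) by auto
      moreover have "\<sigma> (i+1) < \<sigma> i" using eO[of i] ij by auto
      ultimately have li: "\<sigma> l < \<sigma> i" by simp
      have "\<not> (\<sigma> i > \<sigma> l \<and> \<sigma> l > \<sigma> j)"
        using pat(2)[of i j "j - i - 1"] ij l(3) by (simp add: dist_Ee_def)
      with li neq[of l j] l have "\<sigma> l < \<sigma> j" by linarith
      with li l ij(4,5) ij(6)[of l] have "edge (\<sigma> i) (\<sigma> l)" "edge (\<sigma> l) (\<sigma> j)"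
        by (auto simp: edge_def)
      with edge_less[of i l] edge_less[of l j] l ij show ?thesis by simp
    qed
    have even_mono: "L (\<sigma> i) \<le> L (\<sigma> j)"
      if ij: "1 \<le> i" "i \<le> j" "j \<le> ?N" "even (\<sigma> i)" "even (\<sigma> j)" for i j
      using ij(2,3,5)
    proof (induction j rule: less_induct)
      case (less j)
      show ?case
      proof (cases "i = j")
        case False
        with less.prems have "i < j" by simp
        then obtain h where h: "i \<le> h" "h < j" "even (\<sigma> h)" "\<And>l. h < l \<Longrightarrow> l < j \<Longrightarrow> odd (\<sigma> l)"
          using ex_last_before[where P = "\<lambda>l. even (\<sigma> l)", OF ij(4)] by blast
        have "L (\<sigma> h) \<le> L (\<sigma> j)"
        proof (cases "j = h + 1")
          case True
          with ee[of h] level_mono[OF \<sigma>(2,1), of h j] h(3) ij(1) h(1) less.prems show ?thesis by simp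
        next
          case False
          with gap[of h j] h ij(1) less.prems show ?thesis by simp
        qed
        with less.IH[of h] h less.prems show ?thesis by simp
      qed simp
    qed
    show "sorted_by K ?N \<sigma>"
      unfolding sorted_by_def
    proof
      fix m assume "m \<in> {1..<?N}"
      then have m: "1 \<le> m" "m < ?N" by auto
      have le: "\<sigma> m \<le> ?N" "\<sigma> (m+1) \<le> ?N"
        using permutes_mem[OF \<sigma>(1), of m] permutes_mem[OF \<sigma>(1), of "m+1"] m by auto
      show "K (\<sigma> m) < K (\<sigma> (m+1))"
      proof (cases "edge (\<sigma> m) (\<sigma> (m+1))")
        case True
        then have "(\<sigma> m, \<sigma> (m+1)) \<in> arcs ?N \<rho>" using arcsI[of m "m+1" ?N \<sigma>] m \<sigma>(2) by simp
        from place_less[OF this] K[OF le] show ?thesis by simp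
      next
        case nonedge: False
        consider "even (\<sigma> m)" "even (\<sigma> (m+1))" | "odd (\<sigma> m)" "odd (\<sigma> (m+1))"
          | "odd (\<sigma> m)" "even (\<sigma> (m+1))"
          using nonedge eO[OF m] by (auto simp: edge_def)
        then show ?thesis
        proof cases
          case 1
          with ee[OF m] even_mono[of m "m+1"] m K[OF le] show ?thesis by auto
        next
          case 2
          have less: "\<sigma> m < \<sigma> (m+1)" by (rule oo[OF m 2])
          have "place (\<sigma> m) \<le> place (\<sigma> (m+1))"
          proof (cases "succs (\<sigma> (m+1)) = {}")
            case True
            with place_le[OF 2(1)] place_nosucc[OF 2(2)] show ?thesis by simp
          next
            case False
            \<comment> \<open>A successor of the larger odd letter \<open>\<sigma> (m+1)\<close>
              exceeds \<open>\<sigma> m\<close> and stands to its right, so it also limits the place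
              of \<open>\<sigma> m\<close>.\<close>
            then obtain y where y: "(\<sigma> (m+1), y) \<in> arcs ?N \<sigma>" "L y = Suc (place (\<sigma> (m+1)))"
              using place_succE[OF 2(2)] \<sigma>(2) by metis
            then obtain j where j: "y = \<sigma> j" "m+1 < j" "j \<le> ?N" "edge (\<sigma> (m+1)) y"
              by (auto elim!: arcsE simp: permutes_eq_iff[OF \<sigma>(1)])
            then have "edge (\<sigma> m) y" using 2 less by (auto simp: edge_def)
            then have "(\<sigma> m, y) \<in> arcs ?N \<rho>" using arcsI[of m j ?N \<sigma>] m j \<sigma>(2) by simp
            from place_less_succ[OF this 2(1)] y(2) show ?thesis by simp
          qed
          with less K[OF le] show ?thesis by auto
        next
          case 3
          \<comment> \<open>The level of \<open>\<sigma> j\<close> is two above that of an even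
            letter left of \<open>m\<close>, and by \<open>gap\<close> the odd letters ending at
            \<open>m\<close> already raise the level by 2.\<close>
          have block: "L (\<sigma> j) = L (\<sigma> (m+1))"
            if j: "m+1 \<le> j" "j \<le> ?N" "\<And>l. m+1 \<le> l \<Longrightarrow> l \<le> j \<Longrightarrow> even (\<sigma> l)" for j
          proof (rule antisym)
            show "L (\<sigma> (m+1)) \<le> L (\<sigma> j)" using even_mono[of "m+1" j] j m by simp
            show "L (\<sigma> j) \<le> L (\<sigma> (m+1))"
            \<comment> \<open>Above 3, both \<open>\<sigma> j\<close> and its predecessor exceed
              level 2, so two steps back exist; up to 3, the even \<open>\<sigma> j\<close> has the
              least even level.\<close>
            proof (cases "L (\<sigma> j) \<le> 3")
              case True
              have "even (L (\<sigma> j))" using level_parity j by simp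
              then have "L (\<sigma> j) \<noteq> 3" by (metis odd_numeral)
              with True level_ge2[OF 3(2)] show ?thesis by linarith
            next
              case False
              then have "L (\<sigma> j) > 2" by simp
              then obtain k where k: "1 \<le> k" "k < j" "edge (\<sigma> k) (\<sigma> j)" "L (\<sigma> j) = Suc (L (\<sigma> k))"
                using pred_pos[OF \<sigma>(2,1)] by blast
              have "odd (\<sigma> k)" using k(3) j(3)[of j] j(1) by (auto simp: edge_def)
              with j(3)[of k] k(2) have "k \<le> m" by force
              have "L (\<sigma> k) > 2" using False k(4) by simp
              then obtain h where h: "1 \<le> h" "h < k" "edge (\<sigma> h) (\<sigma> k)" "L (\<sigma> k) = Suc (L (\<sigma> h))"
                using pred_pos[OF \<sigma>(2,1)] by blast
              have eh: "even (\<sigma> h)" using h(3) \<open>odd (\<sigma> k)\<close> by (auto simp: edge_def)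
              have hm: "h < m+1" using h(2) \<open>k \<le> m\<close> by simp
              obtain i where i: "h \<le> i" "i < m+1" "even (\<sigma> i)" "\<And>l. i < l \<Longrightarrow> l < m+1 \<Longrightarrow> odd (\<sigma> l)"
                using ex_last_before[where P = "\<lambda>l. even (\<sigma> l)", OF eh hm] by blast
              have "i \<noteq> m" using i(3) 3(1) by auto
              then have "L (\<sigma> i) + 2 \<le> L (\<sigma> (m+1))" using gap[of i "m+1"] i h(1) m 3(2) by simp
              moreover have "L (\<sigma> h) \<le> L (\<sigma> i)" using even_mono[of h i] h(1) i eh m by simp
              ultimately show ?thesis using h(4) k(4) by simp
            qed
          qed
          have "place (\<sigma> m) < L (\<sigma> (m+1))"
          proof (cases "\<exists>q>m. q \<le> ?N \<and> odd (\<sigma> q)")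
            case True
            define q where "q = (LEAST q. q > m \<and> q \<le> ?N \<and> odd (\<sigma> q))"
            have q: "q > m" "q \<le> ?N" "odd (\<sigma> q)" using LeastI_ex[OF True] by (auto simp: q_def)
            have least: "even (\<sigma> l)" if "m < l" "l < q" for l
              using not_less_Least[of l "\<lambda>q. q > m \<and> q \<le> ?N \<and> odd (\<sigma> q)"] that q(2) by (auto simp: q_def)
            have "q \<noteq> m+1" using q(3) 3(2) by auto
            with q have "m + 1 < q" by simp
            have ne: "\<sigma> ` {m<..<q} \<noteq> {}" "finite (\<sigma> ` {m<..<q})" using \<open>m+1 < q\<close> by auto
            \<comment> \<open>The largest letter of the even block exceeds \<open>\<sigma> q\<close>
              by the absence of \<open>eO\<close>, hence exceeds \<open>\<sigma> m\<close> by that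
              of \<open>Oo_d\<close>, and so is a successor of \<open>\<sigma> m\<close>.\<close>
            obtain l where l: "m < l" "l < q" "\<sigma> l = Max (\<sigma> ` {m<..<q})" using Max_in[OF ne(2,1)] by auto
            have "\<sigma> q < \<sigma> (q - 1)" using eO[of "q - 1"] least[of "q - 1"] q m \<open>m+1 < q\<close> by simp
            moreover have "\<sigma> (q - 1) \<le> \<sigma> l"
              unfolding l(3) using \<open>m+1 < q\<close> by (intro Max_ge ne imageI) auto
            moreover have "\<not> (\<sigma> m > \<sigma> l \<and> \<sigma> l > \<sigma> q)"
              using pat(1)[of m q "q - m - 1"] m q \<open>m+1 < q\<close> 3(1) least l(3) by (simp add: dist_Oo_def)
            ultimately have "\<sigma> m < \<sigma> l" using neq[of m l] l(1) by simp
            then have "(\<sigma> m, \<sigma> l) \<in> arcs ?N \<rho>"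
              using arcsI[of m l ?N \<sigma>] m l q(2) 3(1) least[of l] \<sigma>(2) by (simp add: edge_def)
            from place_less_succ[OF this 3(1)] show ?thesis
              using block[of l] l q(2) least by simp
          next
            case False
            then have ev: "even (\<sigma> l)" if "m+1 \<le> l" "l \<le> ?N" for l using that by auto
            have top: "top_level = L (\<sigma> (m+1))"
            proof (rule antisym)
              obtain a where a: "1 \<le> a" "a \<le> ?N" "even a" "L a = top_level" by (rule top_levelE)
              obtain j where j: "1 \<le> j" "j \<le> ?N" "a = \<sigma> j" by (rule permutes_posE[OF \<sigma>(1) a(1,2)])
              have "L (\<sigma> j) \<le> L (\<sigma> (m+1))"
              proof (cases "j \<le> m")
                case True
                with even_mono[of j "m+1"] j a m 3(2) show ?thesis by simp
              next
                case False
                with block[of j] j ev show ?thesis by simp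
              qed
              with a j show "top_level \<le> L (\<sigma> (m+1))" by simp
              show "L (\<sigma> (m+1)) \<le> top_level"
                using level_le_top[OF 3(2)] permutes_mem[OF \<sigma>(1), of "m+1"] m by simp
            qed
            \<comment> \<open>An arc out of the top level would end in an odd letter left of the
              final even block, and by \<open>gap\<close> that block would lie two levels above the
              top.\<close>
            have "\<not> overflow"
            proof
              assume overflow
              then obtain z w where zw: "(z, w) \<in> arcs ?N \<sigma>" "L z = top_level"
                using \<sigma>(2) by (auto simp: overflow_def)
              obtain h k where hk: "z = \<sigma> h" "w = \<sigma> k" "1 \<le> h" "h < k" "k \<le> ?N" "edge (\<sigma> h) (\<sigma> k)"
                using zw(1) by (rule arcsE)
              have eh: "even (\<sigma> h)" using zw(2) hk(1) even_top_level level_parity by metis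
              then have "odd (\<sigma> k)" using hk(6) by (auto simp: edge_def)
              then have "k \<le> m" using ev[of k] hk(5) by force
              have hm: "h < m+1" using hk(4) \<open>k \<le> m\<close> by simp
              obtain i where i: "h \<le> i" "i < m+1" "even (\<sigma> i)" "\<And>l. i < l \<Longrightarrow> l < m+1 \<Longrightarrow> odd (\<sigma> l)"
                using ex_last_before[where P = "\<lambda>l. even (\<sigma> l)", OF eh hm] by blast
              have "i \<noteq> m" using i(3) 3(1) by auto
              then have "L (\<sigma> i) + 2 \<le> L (\<sigma> (m+1))" using gap[of i "m+1"] i hk(3) m 3(2) by simp
              moreover have "L (\<sigma> h) \<le> L (\<sigma> i)" using even_mono[of h i] hk(3) i eh m by simp
              ultimately show False using zw(2) hk(1) top by simp
            qed
            then have "place (\<sigma> m) \<le> top_level - 1" using place_le[OF 3(1)] by simp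
            with top top_level_ge2 show ?thesis by simp
          qed
          with K[OF le] 3 show ?thesis by simp
        qed
      qed
    qed
  next
    fix \<sigma> assume \<sigma>: "\<sigma> permutes {1..?N}" "arcs ?N \<sigma> = arcs ?N \<rho>" "sorted_by K ?N \<sigma>"
    have ord: "place (\<sigma> i) < place (\<sigma> j) \<or> place (\<sigma> i) = place (\<sigma> j) \<and> \<sigma> i < \<sigma> j"
      if "1 \<le> i" "i < j" "j \<le> ?N" for i j
      using K[of "\<sigma> i" "\<sigma> j"] sorted_by_less[OF \<sigma>(3) that] that
        permutes_mem[OF \<sigma>(1), of i] permutes_mem[OF \<sigma>(1), of j] by simp
    have between: "\<exists>l. i < l \<and> l < j \<and> \<sigma> l = c"
      if ij: "1 \<le> i" "i < j" "j \<le> ?N" and c: "1 \<le> c" "c \<le> ?N" "place (\<sigma> i) < place c" "place c < place (\<sigma> j)"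
      for i j c
    proof -
      obtain l where l: "1 \<le> l" "l \<le> ?N" "c = \<sigma> l" by (rule permutes_posE[OF \<sigma>(1) c(1,2)])
      have "\<not> l \<le> i" using ord[of l i] l ij c by (cases "l = i") auto
      moreover have "\<not> j \<le> l" using ord[of j l] l ij c by (cases "l = j") auto
      ultimately show ?thesis using l by (intro exI[of _ l]) auto
    qed
    have "\<not> asc_eO \<sigma> m" if m: "m \<in> {1..<?N}" for m
    proof
      assume "asc_eO \<sigma> m"
      then have eo: "even (\<sigma> m)" "odd (\<sigma> (m+1))" "\<sigma> m < \<sigma> (m+1)" by (auto simp: asc_eO_def)
      then have less: "place (\<sigma> m) < place (\<sigma> (m+1))"
        using ord[of m "m+1"] m place_parity[of "\<sigma> m"] place_parity[of "\<sigma> (m+1)"] by auto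
      with level_ge2[OF eo(1)] eo(1) have "2 < place (\<sigma> (m+1))" by simp
      then obtain c d where cd: "(d, c) \<in> arcs ?N \<rho>" "odd c" "even d" "place c = place (\<sigma> (m+1))"
          "place (\<sigma> (m+1)) = Suc (L d)"
        by (rule odd_predE[OF eo(2)])
      obtain k l where kl: "d = \<sigma> k" "c = \<sigma> l" "1 \<le> k" "k < l" "l \<le> ?N" "edge d c"
        using cd(1) \<sigma>(2) by (metis arcsE)
      \<comment> \<open>\<open>\<sigma> m\<close> is the last, hence largest, letter of the block of
        \<open>d\<close>, and \<open>\<sigma> (m+1)\<close> the first, hence smallest, of the block
        of \<open>c\<close>; the ascent would give \<open>d < c\<close> against the edge.\<close>
      have "d \<le> \<sigma> m"
      proof (cases "k \<le> m")
        case True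
        with ord[of k m] kl m cd(3,5) less show ?thesis by (cases "k = m") auto
      next
        case False
        with ord[of "m+1" k] kl m cd(3,5) show ?thesis by (cases "k = m+1") auto
      qed
      moreover have "\<sigma> (m+1) \<le> c"
      proof (cases "l \<le> m")
        case True
        with ord[of l m] kl m cd(4) less show ?thesis by (cases "l = m") auto
      next
        case False
        with ord[of "m+1" l] kl m cd(4) show ?thesis by (cases "l = m+1") auto
      qed
      ultimately show False using eo(3) kl(6) cd(2,3) by (auto simp: edge_def)
    qed
    moreover have "\<not> dist_Oo d \<sigma> i j" if ij: "i \<in> {1..?N}" "j \<in> {1..?N}" for d i j
    proof
      assume D: "dist_Oo d \<sigma> i j"
      then have j: "j = i + d + 1" and o: "odd (\<sigma> i)" "odd (\<sigma> j)" by (auto simp: dist_Oo_def)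
      have desc: "\<sigma> j < \<sigma> i" using D by (auto simp: dist_Oo_def split: if_splits)
      then have less: "place (\<sigma> i) < place (\<sigma> j)" using ord[of i j] ij j by auto
      \<comment> \<open>Without successors \<open>\<sigma> i\<close> would already have the largest
        place possible for an odd letter.\<close>
      then have ne: "succs (\<sigma> i) \<noteq> {}" using place_le[OF o(2)] place_nosucc[OF o(1)] by auto
      \<comment> \<open>The even letter that keeps \<open>\<sigma> i\<close> from moving further
        right stands between the two odd letters and exceeds \<open>\<sigma> i\<close>.\<close>
      obtain s where s: "(\<sigma> i, s) \<in> arcs ?N \<rho>" "L s = Suc (place (\<sigma> i))"
        by (rule place_succE[OF o(1) ne])
      have es: "even s" "\<sigma> i < s" using arcs_edge[OF s(1)] o(1) by (auto simp: edge_def)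
      have "place s \<noteq> place (\<sigma> j)" using place_parity[of s] place_parity[of "\<sigma> j"] es o(2) by auto
      with less s(2) es(1) have "place s < place (\<sigma> j)" by simp
      then obtain l where l: "i < l" "l < j" "\<sigma> l = s"
        using between[of i j s] arcs_mem[OF s(1) assms(2)] ij j s(2) es(1) by auto
      then have "d \<noteq> 0" using j by auto
      then have "Max (\<sigma> ` {i<..<j}) < \<sigma> i" using D by (auto simp: dist_Oo_def)
      moreover have "s \<le> Max (\<sigma> ` {i<..<j})" using l by (intro Max_ge) auto
      ultimately show False using es(2) by simp
    qed
    moreover have "\<not> dist_Ee d \<sigma> i j" if ij: "i \<in> {1..?N}" "j \<in> {1..?N}" for d i j
    proof
      assume D: "dist_Ee d \<sigma> i j"
      then have j: "j = i + d + 1" and e: "even (\<sigma> i)" "even (\<sigma> j)" by (auto simp: dist_Ee_def)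
      have desc: "\<sigma> j < \<sigma> i" using D by (auto simp: dist_Ee_def split: if_splits)
      then have less: "L (\<sigma> i) < L (\<sigma> j)" using ord[of i j] ij j e by auto
      with level_ge2[OF e(1)] have "2 < L (\<sigma> j)" by simp
      \<comment> \<open>Dually, the odd letter that realises the level of \<open>\<sigma> j\<close>
        stands between the two even letters and is below \<open>\<sigma> j\<close>.\<close>
      then obtain c where c: "odd c" "(c, \<sigma> j) \<in> arcs ?N \<rho>" "L (\<sigma> j) = Suc (L c)" "place c = L c"
        by (rule even_predE[OF e(2)])
      have "L (\<sigma> i) \<noteq> L c" using level_parity[of c] level_parity[of "\<sigma> i"] c(1) e(1) by auto
      with less c have "place (\<sigma> i) < place c" "place c < place (\<sigma> j)" using e by auto
      then obtain l where l: "i < l" "l < j" "\<sigma> l = c"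
        using between[of i j c] arcs_mem[OF c(2) assms(2)] ij j by auto
      have "c < \<sigma> j" using arcs_edge[OF c(2)] c(1) by (auto simp: edge_def)
      moreover have "d \<noteq> 0" using j l by auto
      then have "\<sigma> j < Min (\<sigma> ` {i<..<j})" using D by (auto simp: dist_Ee_def)
      moreover have "Min (\<sigma> ` {i<..<j}) \<le> c" using l by (intro Min_le) auto
      ultimately show False by simp
    qed
    ultimately show "\<sigma> \<in> G_IV n" using \<sigma>(1) by (auto simp: G_IV_def)
  qed (rule assms)
qed

section \<open>Regions\<close>

definition cell :: "nat \<Rightarrow> (nat \<Rightarrow> nat) \<Rightarrow> (nat \<Rightarrow> real) set" where
  "cell n \<rho> = {x \<in> topspace (ambient n). \<forall>a b. (a, b) \<in> arcs (2*n) \<rho> \<longrightarrow> x a < x b}"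

abbreviation arrangement_complement :: "nat \<Rightarrow> (nat \<Rightarrow> real) topology" where
  "arrangement_complement n \<equiv> subtopology (ambient n) (topspace (ambient n) - \<Union>(arrangement n))"

text \<open>Edges and hyperplanes correspond: for \<open>a = 2*i-1\<close> and
  \<open>b = 2*j\<close>, the condition \<open>a < b\<close> amounts to
  \<open>i \<le> j\<close>.\<close>

lemma not_in_arrangement_iff:
  assumes "x \<in> topspace (ambient n)"
  shows "x \<notin> \<Union>(arrangement n) \<longleftrightarrow>
    (\<forall>a b. 1 \<le> a \<and> a \<le> 2*n \<and> 1 \<le> b \<and> b \<le> 2*n \<and> edge a b \<longrightarrow> x a \<noteq> x b)" (is "_ \<longleftrightarrow> ?R")
proof
  assume x: "x \<notin> \<Union>(arrangement n)"
  have "x a \<noteq> x b" if ab: "1 \<le> a" "b \<le> 2*n" "odd a" "even b" "a < b" for a b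
  proof -
    obtain k j where "a = 2*k+1" "b = 2*j" using ab(3,4) by (metis evenE oddE)
    then have ij: "a = 2*(k+1)-1" "1 \<le> k+1" "b = 2*j" "k+1 \<le> j" "j \<le> n" using ab(2,5) by auto
    show ?thesis
    proof
      assume "x a = x b"
      with assms ij have "x \<in> {x \<in> topspace (ambient n). x (2*(k+1)-1) - x (2*j) = 0}" by simp
      moreover have "\<dots> \<in> arrangement n" unfolding arrangement_def using ij by blast
      ultimately show False using x by blast
    qed
  qed
  then show ?R unfolding edge_def by metis
next
  assume R: ?R
  show "x \<notin> \<Union>(arrangement n)"
  proof
    assume "x \<in> \<Union>(arrangement n)"
    then obtain i j where ij: "1 \<le> i" "i \<le> j" "j \<le> n" "x (2*i-1) = x (2*j)"
      by (auto simp: arrangement_def)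
    moreover have "edge (2*i-1) (2*j)" using ij by (auto simp: edge_def)
    moreover have "1 \<le> 2*i-1 \<and> 2*i-1 \<le> 2*n \<and> 1 \<le> 2*j \<and> 2*j \<le> 2*n" using ij by arith
    ultimately show False using R[rule_format, of "2*i-1" "2*j"] by blast
  qed
qed

lemma cell_subset: 
  assumes "\<rho> permutes {1..2*n}"
  shows "cell n \<rho> \<subseteq> topspace (arrangement_complement n)"
proof
  fix x assume x: "x \<in> cell n \<rho>"
  then have top: "x \<in> topspace (ambient n)" by (simp add: cell_def)
  have "x a \<noteq> x b" if "1 \<le> a \<and> a \<le> 2*n \<and> 1 \<le> b \<and> b \<le> 2*n \<and> edge a b" for a b
  proof -
    have "x a < x b \<or> x b < x a" using arcs_total[OF assms, of a b] that x unfolding cell_def by blast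
    then show ?thesis by linarith
  qed
  with top not_in_arrangement_iff[OF top] show "x \<in> topspace (arrangement_complement n)" by simp
qed

lemma cell_nonempty:
  assumes "\<rho> permutes {1..2*n}"
  shows "cell n \<rho> \<noteq> {}"
proof -
  \<comment> \<open>The positions in the word serve as coordinates, as an arc leads from an earlier
    letter to a later one.\<close>
  let ?x = "\<lambda>k\<in>{1..2*n+1}. real (inv \<rho> k)"
  have "?x a < ?x b" if "(a, b) \<in> arcs (2*n) \<rho>" for a b
    using arcs_mem[OF that assms] arcs_inv[OF assms, of a b] that by simp
  then have "?x \<in> cell n \<rho>" by (simp add: cell_def del: restrict_apply)
  then show ?thesis by blast
qed

text \<open>Sort the letters by their coordinates. Letters without an edge may have equal
  coordinates, and then the letter itself breaks the tie.\<close>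

lemma cell_exists:
  assumes "x \<in> topspace (arrangement_complement n)"
  obtains \<rho> where "\<rho> permutes {1..2*n}" "x \<in> cell n \<rho>"
proof -
  let ?N = "2*n"
  have top: "x \<in> topspace (ambient n)" and ne: "x \<notin> \<Union>(arrangement n)" using assms by auto
  \<comment> \<open>Ranks stand in for the real coordinates, as keys are natural numbers.\<close>
  define r where "r a = card {b\<in>{1..?N}. x b < x a}" for a
  define K where "K a = r a * (?N+1) + a" for a
  have K: "K a < K b \<longleftrightarrow> r a < r b \<or> r a = r b \<and> a < b" if "a \<le> ?N" "b \<le> ?N" for a b
    unfolding K_def using that by (intro lex_less_iff) auto
  have "inj_on K {1..?N}"
  proof (rule inj_onI)
    fix a b assume "a \<in> {1..?N}" "b \<in> {1..?N}" "K a = K b"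
    then show "a = b" using K[of a b] K[of b a] by auto
  qed
  then obtain \<rho> where \<rho>: "\<rho> permutes {1..?N}" "sorted_by K ?N \<rho>" using sorted_by_ex by blast
  have r: "r a < r b" if "1 \<le> a" "a \<le> ?N" "x a < x b" for a b
  proof -
    have "a \<in> {c\<in>{1..?N}. x c < x b} - {c\<in>{1..?N}. x c < x a}"
      "{c\<in>{1..?N}. x c < x a} \<subseteq> {c\<in>{1..?N}. x c < x b}"
      using that by auto
    then have "{c\<in>{1..?N}. x c < x a} \<subset> {c\<in>{1..?N}. x c < x b}" by blast
    then show ?thesis unfolding r_def by (intro psubset_card_mono) auto
  qed
  have "x a < x b" if ab: "(a, b) \<in> arcs ?N \<rho>" for a b
  proof -
    have mem: "1 \<le> a" "a \<le> ?N" "1 \<le> b" "b \<le> ?N" by (rule arcs_mem[OF ab \<rho>(1)])+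
    have "x a \<noteq> x b" 
      using not_in_arrangement_iff[OF top, THEN iffD1, OF ne] mem arcs_edge[OF ab] by blast
    moreover have "K a < K b" using ab by (auto elim!: arcsE intro: sorted_by_less[OF \<rho>(2)])
    ultimately show ?thesis using K[of a b] r[of b a] mem by force
  qed
  with top \<rho>(1) show thesis by (intro that[of \<rho>]) (auto simp: cell_def)
qed

text \<open>Cells are convex: the segment from \<open>x\<close> to \<open>y\<close> stays
  inside.\<close>

lemma cell_connected:
  assumes "\<rho> permutes {1..2*n}" "x \<in> cell n \<rho>" "y \<in> cell n \<rho>"
  shows "connected_component_of (arrangement_complement n) x y"
proof -
  let ?I = "{1..2*n+1}"
  define f where "f t = (\<lambda>k\<in>?I. (1 - t) * x k + t * y k)" for t :: real
  have ext: "x \<in> extensional ?I" "y \<in> extensional ?I"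
    using assms(2,3) by (auto simp: cell_def PiE_def)
  have "continuous_map (top_of_set {0..1}) (ambient n) f"
    unfolding continuous_map_componentwise
  proof (intro conjI ballI)
    show "f ` topspace (top_of_set {0..1}) \<subseteq> extensional ?I" by (auto simp: f_def)
    fix k assume "k \<in> ?I"
    then have "(\<lambda>t. f t k) = (\<lambda>t. (1 - t) * x k + t * y k)" by (auto simp: f_def)
    moreover have "continuous_on {0..1} (\<lambda>t. (1 - t) * x k + t * y k)" by (intro continuous_intros)
    ultimately show "continuous_map (top_of_set {0..1}) euclideanreal (\<lambda>t. f t k)" by simp
  qed
  moreover have "connectedin (top_of_set {0..1}) {0..1::real}"
    by (simp add: connectedin_subtopology)
  ultimately have "connectedin (ambient n) (f ` {0..1})" by (rule connectedin_continuous_map_image)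
  moreover have "f ` {0..1} \<subseteq> cell n \<rho>"
  proof (rule image_subsetI)
    fix t :: real assume t: "t \<in> {0..1}"
    have "f t a < f t b" if ab: "(a, b) \<in> arcs (2*n) \<rho>" for a b
    proof -
      have less: "x a < x b" "y a < y b" using assms(2,3) ab by (auto simp: cell_def)
      have "(1 - t) * x a + t * y a < (1 - t) * x b + t * y b"
      \<comment> \<open>Strictness comes from \<open>x\<close> at \<open>t = 0\<close> and from
        \<open>y\<close> otherwise.\<close>
      proof (cases "t = 0")
        case False
        then show ?thesis using less t by (intro add_le_less_mono mult_left_mono mult_strict_left_mono) auto
      qed (use less in simp)
      then show ?thesis using arcs_mem[OF ab assms(1)] by (simp add: f_def)
    qed
    then show "f t \<in> cell n \<rho>" by (auto simp: cell_def f_def)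
  qed
  ultimately have "connectedin (arrangement_complement n) (f ` {0..1})"
    using cell_subset[OF assms(1)] unfolding connectedin_subtopology topspace_subtopology by blast
  moreover have "f 0 = x" "f 1 = y"
    using ext by (auto simp: f_def extensional_def restrict_def fun_eq_iff)
  then have "x \<in> f ` {0..1}" "y \<in> f ` {0..1}" by (metis atLeastAtMost_iff imageI order_refl zero_le_one)+
  ultimately show ?thesis unfolding connected_component_of_def by blast
qed

text \<open>By the intermediate value theorem, a sign change of \<open>z b - z a\<close> on a
  connected set would produce a point on a hyperplane.\<close>

lemma cell_closed_under_component:
  assumes "\<rho> permutes {1..2*n}" "x \<in> cell n \<rho>"
    and "connected_component_of (arrangement_complement n) x y"
  shows "y \<in> cell n \<rho>"
proof -
  obtain S where S: "connectedin (arrangement_complement n) S" "x \<in> S" "y \<in> S"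
    using assms(3) unfolding connected_component_of_def by blast
  then have sub: "S \<subseteq> topspace (arrangement_complement n)" and conn: "connectedin (ambient n) S"
    by (auto simp: connectedin_subtopology dest: connectedin_subset_topspace)
  have "y a < y b" if ab: "(a, b) \<in> arcs (2*n) \<rho>" for a b
  proof (rule ccontr)
    assume neg: "\<not> y a < y b"
    have mem: "1 \<le> a" "a \<le> 2*n" "1 \<le> b" "b \<le> 2*n" by (rule arcs_mem[OF ab assms(1)])+
    have "continuous_map (ambient n) euclideanreal (\<lambda>z. z b - z a)"
      using mem by (intro continuous_map_diff continuous_map_product_coordinates) auto
    from connectedin_continuous_map_image[OF this conn]
    have "connected ((\<lambda>z. z b - z a) ` S)" by simp
    moreover have "y b - y a \<in> (\<lambda>z. z b - z a) ` S" "x b - x a \<in> (\<lambda>z. z b - z a) ` S" using S by auto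
    ultimately have "{y b - y a..x b - x a} \<subseteq> (\<lambda>z. z b - z a) ` S" by (rule connected_contains_Icc)
    moreover have "0 \<in> {y b - y a..x b - x a}" using neg assms(2) ab by (auto simp: cell_def less_imp_le)
    ultimately obtain z where "z \<in> S" "0 = z b - z a" by blast
    then have "z \<in> S" "z a = z b" by auto
    with sub not_in_arrangement_iff[of z n] mem arcs_edge[OF ab] show False by auto
  qed
  with sub S(3) show ?thesis by (auto simp: cell_def)
qed

section \<open>Regions as cells of arc sets\<close>

lemma component_eq_cell:
  assumes "\<rho> permutes {1..2*n}" "x \<in> cell n \<rho>"
  shows "connected_component_of_set (arrangement_complement n) x = cell n \<rho>"
  using cell_connected[OF assms] cell_closed_under_component[OF assms] by blast

lemma regions_eq: "regions n = cell n ` {\<rho>. \<rho> permutes {1..2*n}}"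
proof (intro set_eqI iffI)
  fix R assume "R \<in> regions n"
  then obtain x where x: "x \<in> topspace (arrangement_complement n)"
      "R = connected_component_of_set (arrangement_complement n) x"
    unfolding regions_def connected_components_of_def by blast
  obtain \<rho> where "\<rho> permutes {1..2*n}" "x \<in> cell n \<rho>" by (rule cell_exists[OF x(1)])
  with x(2) component_eq_cell show "R \<in> cell n ` {\<rho>. \<rho> permutes {1..2*n}}" by blast
next
  fix R assume "R \<in> cell n ` {\<rho>. \<rho> permutes {1..2*n}}"
  then obtain \<rho> where \<rho>: "\<rho> permutes {1..2*n}" "R = cell n \<rho>" by blast
  then obtain x where "x \<in> cell n \<rho>" using cell_nonempty by blast
  with component_eq_cell[OF \<rho>(1)] \<rho> cell_subset[OF \<rho>(1)] show "R \<in> regions n"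
    unfolding regions_def connected_components_of_def by blast
qed

text \<open>\<open>compatible\<close> asks about each edge once, from its odd end; the reversed
  orientation follows because exactly one of the two occurs.\<close>

lemma compatible_cell_iff:
  assumes "\<sigma> permutes {1..2*n}" "\<rho> permutes {1..2*n}"
  shows "compatible n \<sigma> (cell n \<rho>) \<longleftrightarrow> arcs (2*n) \<sigma> = arcs (2*n) \<rho>"
proof
  assume C: "compatible n \<sigma> (cell n \<rho>)"
  \<comment> \<open>A point is needed, since compatibility with an empty set would say
    nothing.\<close>
  obtain x where x: "x \<in> cell n \<rho>" using cell_nonempty[OF assms(2)] by blast
  have x_iff: "(a, b) \<in> arcs (2*n) \<rho> \<longleftrightarrow> x a < x b"
    if "1 \<le> a" "a \<le> 2*n" "1 \<le> b" "b \<le> 2*n" "edge a b" for a b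
    using x arcs_total[OF assms(2) that] by (auto simp: cell_def dest: order_less_asym)
  have iff: "(a, b) \<in> arcs (2*n) \<sigma> \<longleftrightarrow> (a, b) \<in> arcs (2*n) \<rho>"
    if "1 \<le> a" "a \<le> 2*n" "1 \<le> b" "b \<le> 2*n" "odd a" "even b" "a < b" for a b
  proof -
    have "edge a b" using that by (simp add: edge_def)
    moreover have "inv \<sigma> a < inv \<sigma> b \<longleftrightarrow> x a < x b" using C x that by (auto simp: compatible_def)
    ultimately show ?thesis using arcs_inv[OF assms(1) that(1-4)] x_iff[OF that(1-4)] by simp
  qed
  show "arcs (2*n) \<sigma> = arcs (2*n) \<rho>"
  proof (rule arcs_subset_eq[OF assms], rule subrelI)
    fix a b assume ab: "(a, b) \<in> arcs (2*n) \<sigma>"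
    note mem = arcs_mem[OF ab assms(1)]
    consider "odd a" "even b" "a < b" | "odd b" "even a" "b < a"
      using arcs_edge[OF ab] by (auto simp: edge_def)
    then show "(a, b) \<in> arcs (2*n) \<rho>"
    proof cases
      case 1
      with iff[of a b] mem ab show ?thesis by simp
    next
      case 2
      with iff[of b a] mem arcs_antisym[OF ab assms(1)] arcs_total[OF assms(2) mem arcs_edge[OF ab]]
      show ?thesis by simp
    qed
  qed
next
  assume eq: "arcs (2*n) \<sigma> = arcs (2*n) \<rho>"
  show "compatible n \<sigma> (cell n \<rho>)"
    unfolding compatible_def
  proof (intro ballI impI)
    fix a b x assume ab: "a \<in> {1..2*n}" "b \<in> {1..2*n}" "a < b \<and> odd a \<and> even b" and x: "x \<in> cell n \<rho>"
    then have e: "edge a b" by (simp add: edge_def)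
    with arcs_inv[OF assms(1), of a b] ab eq have "inv \<sigma> a < inv \<sigma> b \<longleftrightarrow> (a, b) \<in> arcs (2*n) \<rho>" by simp
    also have "\<dots> \<longleftrightarrow> x a < x b"
      using x arcs_total[OF assms(2), of a b] e ab by (auto simp: cell_def dest: order_less_asym)
    finally show "inv \<sigma> a < inv \<sigma> b \<longleftrightarrow> x a < x b" .
  qed
qed

text \<open>A region is the cell of the permutation assigned to it, so \<open>cell n\<close> inverts
  the map.\<close>

lemma region_perm_bij:
  assumes X: "\<And>\<sigma>. \<sigma> \<in> X \<Longrightarrow> \<sigma> permutes {1..2*n}"
    and ex1: "\<And>\<rho>. \<rho> permutes {1..2*n} \<Longrightarrow> \<exists>!\<sigma>. \<sigma> \<in> X \<and> arcs (2*n) \<sigma> = arcs (2*n) \<rho>"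
  shows "(\<forall>R\<in>regions n. \<exists>!\<sigma>. \<sigma> \<in> X \<and> compatible n \<sigma> R) \<and>
    bij_betw (region_perm n X) (regions n) X"
proof
  have eq: "(\<sigma> \<in> X \<and> compatible n \<sigma> (cell n \<rho>)) \<longleftrightarrow> (\<sigma> \<in> X \<and> arcs (2*n) \<sigma> = arcs (2*n) \<rho>)"
    if "\<rho> permutes {1..2*n}" for \<sigma> \<rho>
    using compatible_cell_iff[OF X that] by blast
  show ex: "\<forall>R\<in>regions n. \<exists>!\<sigma>. \<sigma> \<in> X \<and> compatible n \<sigma> R"
    unfolding regions_eq using eq ex1 by simp
  have the: "region_perm n X R \<in> X \<and> compatible n (region_perm n X R) R" if "R \<in> regions n" for R
    unfolding region_perm_def by (rule theI'[OF bspec[OF ex that]])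
  have cell: "R = cell n (region_perm n X R)" if R: "R \<in> regions n" for R
  proof -
    obtain \<rho> where \<rho>: "\<rho> permutes {1..2*n}" "R = cell n \<rho>" using R by (auto simp: regions_eq)
    then have "arcs (2*n) (region_perm n X R) = arcs (2*n) \<rho>" using the[OF R] eq by blast
    then show ?thesis unfolding \<rho>(2) by (simp add: cell_def)
  qed
  show "bij_betw (region_perm n X) (regions n) X"
    unfolding bij_betw_def
  proof
    show "inj_on (region_perm n X) (regions n)" 
      by (rule inj_on_inverseI[where g = "cell n"]) (rule cell[symmetric])
    show "region_perm n X ` regions n = X"
    proof
      show "region_perm n X ` regions n \<subseteq> X" using the by blast
      show "X \<subseteq> region_perm n X ` regions n"
      proof
        fix \<sigma> assume \<sigma>: "\<sigma> \<in> X"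
        have R: "cell n \<sigma> \<in> regions n" using X[OF \<sigma>] by (auto simp: regions_eq)
        have "compatible n \<sigma> (cell n \<sigma>)" using compatible_cell_iff[OF X[OF \<sigma>] X[OF \<sigma>]] by simp
        with ex R \<sigma> the[OF R] have "\<sigma> = region_perm n X (cell n \<sigma>)" by blast
        with R show "\<sigma> \<in> region_perm n X ` regions n" by blast
      qed
    qed
  qed
qed

theorem theorem3p6:
  fixes n :: nat and X :: "(nat \<Rightarrow> nat) set"
  assumes "n \<ge> 1"
    and "X \<in> {G_II n, G_III n, G_IV n}"
  shows "(\<forall>R\<in>regions n. \<exists>!\<sigma>. \<sigma> \<in> X \<and> compatible n \<sigma> R) \<and>
    bij_betw (region_perm n X) (regions n) X"
proof (rule region_perm_bij)
  show "\<sigma> permutes {1..2*n}" if "\<sigma> \<in> X" for \<sigma>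
    using that assms(2) by (auto simp: G_II_def G_III_def G_IV_def)
  show "\<exists>!\<sigma>. \<sigma> \<in> X \<and> arcs (2*n) \<sigma> = arcs (2*n) \<rho>" if "\<rho> permutes {1..2*n}" for \<rho>
  proof -
    consider "X = G_II n" | "X = G_III n" | "X = G_IV n" using assms(2) by blast
    then show ?thesis
    proof cases
      case 1
      with ex1_G_II[OF that] show ?thesis by simp
    next
      case 2
      with ex1_G_III[OF that] show ?thesis by simp
    next
      case 3
      with ex1_G_IV[OF assms(1) that] show ?thesis by simp
    qed
  qed
qed

end
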